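(* Let $n\ge1$ and let $\lambda$ be a partition with $l(\lambda)\le 2n$, regarded as having $2n$ parts (zeros allowed). If $\lambda=\mu^2$ for some partition $\mu$, i.e. $\lambda_{2i-1}=\lambda_{2i}=\mu_i$ for $1\le i\le n$, then $$\frac1Z\int_T P_\lambda(x_1^{\pm1},\dots,x_n^{\pm1};t)\,\tilde\Delta_K^{(n)}(x;\sqrt t,-\sqrt t,0,0;t)\,dT=\frac{\phi_n(t^2)}{(1-t^2)^n\,v_\mu(t^2)}=\frac{C^0_\mu(t^{2n};0,t^2)}{C^-_\mu(t^2;0,t^2)},$$ and otherwise the left-hand side is $0$. Here $Z=\int_T\tilde\Delta_K^{(n)}(x;\sqrt t,-\sqrt t,0,0;t)\,dT$.
   Context: Let $t\in\mathbb{C}$ with $|t|<1$ and fix a square root $\sqrt t$. $T=\{(x_1,\dots,x_n):|x_1|=\dots=|x_n|=1\}$, $dT=\prod_j\frac{dx_j}{2\pi\sqrt{-1}\,x_j}$. $\phi_r(t)=(1-t)(1-t^2)\cdots(1-t^r)$, so $\phi_n(t^2)=(1-t^2)(1-t^4)\cdots(1-t^{2n})$. For a partition $\lambda$ with $N$ parts (zeros included), $m_i(\lambda)$ is the number of parts equal to $i$ (so $m_0$ counts zero parts) and $v_\lambda(t)=\prod_{i\ge0}\prod_{j=1}^{m_i(\lambda)}\frac{1-t^j}{1-t}$; for $v_\mu(t^2)$, $\mu$ is regarded as having $n$ parts and $t$ is replaced by $t^2$. The Hall--Littlewood polynomial in $N$ variables is $P_\lambda(z_1,\dots,z_N;t)=\frac{1}{v_\lambda(t)}\sum_{w\in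 S_N}w\Big(z^\lambda\prod_{1\le i<j\le N}\frac{z_i-tz_j}{z_i-z_j}\Big)$, with $w$ permuting the subscripts of the variables; here it is evaluated at the $2n$ arguments $x_1,x_1^{-1},\dots,x_n,x_n^{-1}$. The symmetric Koornwinder density is $$\tilde\Delta_K^{(n)}(x;a,b,c,d;t)=\frac{1}{2^nn!}\prod_{1\le i\le n}\frac{1-x_i^{\pm2}}{(1-ax_i^{\pm1})(1-bx_i^{\pm1})(1-cx_i^{\pm1})(1-dx_i^{\pm1})}\prod_{1\le i<j\le n}\frac{1-x_i^{\pm1}x_j^{\pm1}}{1-tx_i^{\pm1}x_j^{\pm1}},$$ where an expression with $\pm$ signs denotes the product over all choices of signs, e.g. $1-x_i^{\pm2}$ means $(1-x_i^2)(1-x_i^{-2})$ and $1-x_i^{\pm1}x_j^{\pm1}$ is a product of four factors. The $C$-symbols at $q=0$, with second parameter $s$ (here $s=t^2$) and $l(\mu)$ the number of nonzero parts, are $C^0_\mu(x;0,s)=\prod_{1\le i\le l(\mu)}(1-s^{1-i}x)$ and $C^-_\mu(s;0,s)=(1-s)^{l(\mu)}\prod_{i\ge1}\prod_{j=1}^{m_i(\mu)}\frac{1-s^j}{1-s}$. *)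

theory Defs
  imports "HOL-Analysis.Analysis"
begin

(* Partitions are infinite weakly decreasing sequences, indexed from 0, with finitely many
   nonzero entries.  Parts, variables and products are indexed from 0 throughout. *)

definition int_partition :: "(nat \<Rightarrow> nat) \<Rightarrow> bool" where
  "int_partition lam \<longleftrightarrow> antimono lam \<and> finite {i. lam i \<noteq> 0}"

definition num_parts :: "(nat \<Rightarrow> nat) \<Rightarrow> nat" where
  "num_parts lam = card {i. lam i \<noteq> 0}"

(* The partition mu^2 = (mu_0, mu_0, mu_1, mu_1, ...). *)
definition double_parts :: "(nat \<Rightarrow> nat) \<Rightarrow> nat \<Rightarrow> nat" where
  "double_parts \<mu> i = \<mu> (i div 2)"

definition part_mult :: "nat \<Rightarrow> (nat \<Rightarrow> nat) \<Rightarrow> nat \<Rightarrow> nat" where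
  "part_mult N lam i = card {k. k < N \<and> lam k = i}"

definition hl_phi :: "nat \<Rightarrow> complex \<Rightarrow> complex" where
  "hl_phi r t = (\<Prod>j=1..r. 1 - t ^ j)"

(* Values i outside the range have multiplicity 0 and contribute the factor 1. *)
definition hl_v :: "nat \<Rightarrow> (nat \<Rightarrow> nat) \<Rightarrow> complex \<Rightarrow> complex" where
  "hl_v N lam t = (\<Prod>i\<in>lam ` {..<N}. \<Prod>j=1..part_mult N lam i. (1 - t ^ j) / (1 - t))"

(* Pointwise value of the symmetrization formula.  It is the value of the Hall-Littlewood
   polynomial at every z with pairwise distinct coordinates z 0, ..., z (N - 1); where two
   coordinates coincide, division by zero makes it meaningless.  At the arguments given by
   inverse_pairs this exceptional set is a null set of the torus. *)
definition hall_littlewood ::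
  "nat \<Rightarrow> (nat \<Rightarrow> nat) \<Rightarrow> complex \<Rightarrow> (nat \<Rightarrow> complex) \<Rightarrow> complex" where
  "hall_littlewood N lam t z =
     1 / hl_v N lam t *
     (\<Sum>w | w permutes {..<N}.
        (\<Prod>i<N. z (w i) ^ lam i) *
        (\<Prod>j<N. \<Prod>i<j. (z (w i) - t * z (w j)) / (z (w i) - z (w j))))"

(* The arguments x_0, 1/x_0, x_1, 1/x_1, ... *)
definition inverse_pairs :: "(nat \<Rightarrow> complex) \<Rightarrow> nat \<Rightarrow> complex" where
  "inverse_pairs x k = (if even k then x (k div 2) else inverse (x (k div 2)))"

(* The product of an expression f(y^(+1)), f(y^(-1)) over both choices of sign. *)
definition prod_pm :: "(complex \<Rightarrow> complex) \<Rightarrow> complex \<Rightarrow> complex" where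
  "prod_pm f y = f y * f (inverse y)"

definition koornwinder_density ::
  "nat \<Rightarrow> complex \<Rightarrow> complex \<Rightarrow> complex \<Rightarrow> complex \<Rightarrow> complex \<Rightarrow> (nat \<Rightarrow> complex) \<Rightarrow> complex" where
  "koornwinder_density n a b c d t x =
     1 / (2 ^ n * fact n) *
     (\<Prod>i<n. prod_pm (\<lambda>y. 1 - y\<^sup>2) (x i) /
        (prod_pm (\<lambda>y. 1 - a * y) (x i) * prod_pm (\<lambda>y. 1 - b * y) (x i) *
         prod_pm (\<lambda>y. 1 - c * y) (x i) * prod_pm (\<lambda>y. 1 - d * y) (x i))) *
     (\<Prod>j<n. \<Prod>i<j.
        prod_pm (\<lambda>y. prod_pm (\<lambda>u. 1 - y * u) (x j)) (x i) /
        prod_pm (\<lambda>y. prod_pm (\<lambda>u. 1 - t * y * u) (x j)) (x i))"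

(* With x = exp(i theta), dx / (2 pi i x) = d theta / (2 pi). *)
definition circle_measure :: "complex measure" where
  "circle_measure = distr (uniform_measure lborel {0..2 * pi}) borel cis"

definition torus_measure :: "nat \<Rightarrow> (nat \<Rightarrow> complex) measure" where
  "torus_measure n = Pi\<^sub>M {..<n} (\<lambda>_. circle_measure)"

(* The C-symbols at q = 0.  With parts indexed from 0, the exponent 1 - i becomes - i.
   For s = 0 the convention 0 powi (- k) = 0 (k > 0) gives the factors i > 0 the value 1; at
   x = s^n with num_parts mu <= n this is the value of 1 - s^(n - i) at s = 0. *)
definition C0_symbol :: "(nat \<Rightarrow> nat) \<Rightarrow> complex \<Rightarrow> complex \<Rightarrow> complex" where
  "C0_symbol \<mu> x s = (\<Prod>i<num_parts \<mu>. 1 - s powi (- int i) * x)"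

(* C^-_mu(s; 0, s): only this specialization of the first argument is defined. *)
definition Cminus_symbol :: "(nat \<Rightarrow> nat) \<Rightarrow> complex \<Rightarrow> complex" where
  "Cminus_symbol \<mu> s =
     (1 - s) ^ num_parts \<mu> *
     (\<Prod>i\<in>range \<mu> - {0}. \<Prod>j=1..card {k. \<mu> k = i}. (1 - s ^ j) / (1 - s))"

end

theory Submission
  imports Defs
    "HOL-Probability.Infinite_Product_Measure"
    "HOL-Complex_Analysis.Cauchy_Integral_Formula"
    "HOL-Combinatorics.Multiset_Permutations"
begin

text \<open>
  The symmetrization formula makes the integral a sum over the orderings of the \<open>2n\<close> letters
  \<open>x\<^sub>0, 1/x\<^sub>0, x\<^sub>1, 1/x\<^sub>1, \<dots>\<close>, and every ordering can be integrated on its own, one pair of letters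
  at a time.  Let \<open>y\<close> be the first letter of an ordering.  All of its factors that involve \<open>y\<close> or
  \<open>1/y\<close>, together with those of the density, simplify to
  \<open>y^(l - l') (1 - y^2) / (1 - t y^2) \<Prod>\<^sub>u (t - y u) / (1 - t y u)\<close>,
  where \<open>l \<ge> l'\<close> are the parts at the positions of \<open>y\<close> and \<open>1/y\<close>, and \<open>u\<close> runs over the letters
  between them; letters after \<open>1/y\<close> contribute the factor 1 (\<open>word_integrand_split\<close>).
  This is holomorphic on the closed unit disc, so its mean over the circle is its value at \<open>y = 0\<close>:
  it vanishes unless \<open>l = l'\<close>, and is otherwise \<open>t\<close> to the number of letters between \<open>y\<close> and \<open>1/y\<close>
  (\<open>integral_word_integrand\<close>).  The remaining \<open>2n - 2\<close> letters form an integrand of the same kind.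

  Hence an ordering survives only if it matches positions carrying equal parts, and the sum over
  all orderings is \<open>2^n n!\<close> times a product over the part values \<open>v\<close> of a generating function of the perfect
  matchings of \<open>m\<^sub>v\<close> points (\<open>sum_integral_words\<close>).  This is 0 for odd \<open>m\<^sub>v\<close>, and
  \<open>\<Prod>\<^sub>j (1 - t^(2j - 1)) / (1 - t)\<close>, over \<open>1 \<le> j \<le> k\<close>, for \<open>m\<^sub>v = 2k\<close>.  All multiplicities of \<open>lam\<close>
  are even exactly if \<open>lam = \<mu>^2\<close>, and then division by \<open>v\<^sub>\<lambda>(t)\<close> cancels the odd factors and leaves
  \<open>\<Prod>\<^sub>v (1 - t)^k / \<phi>\<^sub>k(t^2)\<close> with \<open>k = m\<^sub>v(\<mu>)\<close>.

  The normalization \<open>Z\<close> is the same integral for \<open>lam = 0\<close>, because \<open>P\<^sub>0 = 1\<close>.  The latter is the identity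
  that the quotients \<open>\<Prod> (z\<^sub>i - t z\<^sub>j) / (z\<^sub>i - z\<^sub>j)\<close>, summed over all orderings of \<open>N\<close> variables, give
  \<open>\<Prod>\<^sub>j (1 - t^j) / (1 - t)\<close>, which follows from Lagrange interpolation
  (\<open>sum_permutations_t_quotients\<close>).
\<close>

section \<open>Integration over the unit circle\<close>

lemma emeasure_lborel_full_turn: "emeasure lborel {0..2 * pi} = ennreal (2 * pi)"
  by simp

lemma borel_measurable_cis [measurable]: "cis \<in> borel_measurable borel"
  by (intro borel_measurable_continuous_onI continuous_intros)

lemma measurable_cis_uniform: "cis \<in> borel_measurable (uniform_measure lborel A)"
  by (subst measurable_cong_sets[OF _ refl, where M' = borel]) auto

lemma prob_space_circle: "prob_space circle_measure"
  unfolding circle_measure_def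
  by (intro prob_space.prob_space_distr prob_space_uniform_measure measurable_cis_uniform) auto

lemma sets_circle [measurable_cong, simp]: "sets circle_measure = sets borel"
  and space_circle [simp]: "space circle_measure = UNIV"
  by (simp_all add: circle_measure_def)

lemma uniform_full_turn_eq_density:
  "uniform_measure lborel {0..2 * pi} =
     density lborel (\<lambda>\<theta>. ennreal (indicator {0..2 * pi} \<theta> / (2 * pi)))"
  unfolding uniform_measure_def
proof (rule density_cong)
  show "AE \<theta> in lborel. indicator {0..2 * pi} \<theta> / emeasure lborel {0..2 * pi} =
      ennreal (indicator {0..2 * pi} \<theta> / (2 * pi))"
    unfolding emeasure_lborel_full_turn
    by (auto split: split_indicator simp: divide_ennreal simp flip: ennreal_1)
qed auto

lemma integral_circle:
  fixes f :: "complex \<Rightarrow> complex"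
  assumes [measurable]: "f \<in> borel_measurable borel"
  shows "(LINT y|circle_measure. f y) =
    (LINT \<theta>|lborel. (indicator {0..2 * pi} \<theta> / (2 * pi)) *\<^sub>R f (cis \<theta>))"
proof -
  have "(LINT y|circle_measure. f y) = (LINT \<theta>|uniform_measure lborel {0..2 * pi}. f (cis \<theta>))"
    unfolding circle_measure_def by (rule integral_distr) (auto intro: measurable_cis_uniform)
  also have "\<dots> = (LINT \<theta>|lborel. (indicator {0..2 * pi} \<theta> / (2 * pi)) *\<^sub>R f (cis \<theta>))"
    unfolding uniform_full_turn_eq_density
    by (rule integral_density) auto
  finally show ?thesis .
qed

text \<open>The substitution \<open>\<theta> \<mapsto> 2\<pi> - \<theta>\<close> maps the interval of integration to itself and inverts \<open>cis \<theta>\<close>.\<close>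
lemma integral_circle_inverse:
  fixes f :: "complex \<Rightarrow> complex"
  assumes [measurable]: "f \<in> borel_measurable borel"
  shows "(LINT y|circle_measure. f (inverse y)) = (LINT y|circle_measure. f y)"
proof -
  have eq: "(indicator {0..2 * pi} (2 * pi + (- 1) * \<theta>) / (2 * pi)) *\<^sub>R f (cis (2 * pi + (- 1) * \<theta>)) =
      (indicator {0..2 * pi} \<theta> / (2 * pi)) *\<^sub>R f (inverse (cis \<theta>))" for \<theta> :: real
  proof -
    have "cis (2 * pi + (- 1) * \<theta>) = cis (2 * pi) / cis \<theta>"
      unfolding cis_divide by simp
    then have "cis (2 * pi + (- 1) * \<theta>) = inverse (cis \<theta>)"
      by (simp only: cis_2pi inverse_eq_divide)
    moreover have "indicator {0..2 * pi} (2 * pi + (- 1) * \<theta>) = (indicator {0..2 * pi} \<theta> :: real)"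
      by (auto simp: indicator_def)
    ultimately show ?thesis
      by (simp only:)
  qed
  have "(LINT y|circle_measure. f y) =
      \<bar>- 1\<bar> *\<^sub>R (LINT \<theta>|lborel. (indicator {0..2 * pi} (2 * pi + (- 1) * \<theta>) / (2 * pi)) *\<^sub>R
        f (cis (2 * pi + (- 1) * \<theta>)))"
    unfolding integral_circle[OF assms]
    by (rule lborel_integral_real_affine) auto
  also have "\<dots> = (LINT y|circle_measure. f (inverse y))"
    unfolding eq by (subst integral_circle) auto
  finally show ?thesis by simp
qed

text \<open>This is Cauchy's integral formula at the centre, with \<open>du / (2\<pi>\<i> u) = d\<theta> / (2\<pi>)\<close>.\<close>
lemma integral_circle_holomorphic:
  assumes cont: "continuous_on (cball 0 1) f" and hol: "f holomorphic_on ball 0 1"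
    and [measurable]: "f \<in> borel_measurable borel"
  shows "(LINT y|circle_measure. f y) = f 0"
proof -
  let ?c = "\<lambda>\<theta>. f (cis \<theta>)"
  have "((\<lambda>u. f u / (u - 0)) has_contour_integral (2 * of_real pi * \<i> * f 0)) (circlepath 0 1)"
    by (rule Cauchy_integral_circlepath[OF cont hol]) simp
  then have "((\<lambda>\<theta>. f (cis \<theta>) / cis \<theta> * \<i> * cis \<theta>) has_integral 2 * of_real pi * \<i> * f 0) {0..2 * pi}"
    unfolding circlepath_def by (subst (asm) has_contour_integral_part_circlepath_iff) auto
  then have "((\<lambda>\<theta>. \<i> * f (cis \<theta>)) has_integral \<i> * (2 * of_real pi * f 0)) {0..2 * pi}"
    by (simp add: mult_ac)
  then have "((\<lambda>\<theta>. (- \<i>) * (\<i> * f (cis \<theta>))) has_integral (- \<i>) * (\<i> * (2 * of_real pi * f 0))) {0..2 * pi}"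
    by (rule has_integral_mult_right)
  then have hk: "(?c has_integral 2 * of_real pi * f 0) {0..2 * pi}"
    by (simp flip: mult.assoc)
  have "continuous_on {0..2 * pi} ?c"
    by (rule continuous_on_compose2[OF cont]) (auto intro!: continuous_intros)
  then have "set_integrable lborel {0..2 * pi} ?c"
    by (rule borel_integrable_atLeastAtMost')
  then have "(LINT \<theta>:{0..2 * pi}|lborel. ?c \<theta>) = integral {0..2 * pi} ?c"
    by (rule set_borel_integral_eq_integral(2))
  also have "\<dots> = 2 * of_real pi * f 0"
    using hk by (rule integral_unique)
  finally have eq: "(LINT \<theta>:{0..2 * pi}|lborel. ?c \<theta>) = 2 * of_real pi * f 0" .
  have "(\<lambda>\<theta>. (indicator {0..2 * pi} \<theta> / (2 * pi)) *\<^sub>R ?c \<theta>) =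
      (\<lambda>\<theta>. (1 / (2 * pi)) *\<^sub>R (indicator {0..2 * pi} \<theta> *\<^sub>R ?c \<theta>))"
    by (rule ext) simp
  then have "(LINT y|circle_measure. f y) = (1 / (2 * pi)) *\<^sub>R (2 * of_real pi * f 0)"
    unfolding integral_circle[OF assms(3)] eq[symmetric] set_lebesgue_integral_def
    by (simp only: integral_scaleR_right)
  also have "\<dots> = f 0"
    by (simp add: scaleR_conv_of_real)
  finally show ?thesis .
qed

lemma AE_circle_norm: "AE y in circle_measure. norm y = 1"
  unfolding circle_measure_def
  by (subst AE_distr_iff) (auto intro: measurable_cis_uniform)

lemma AE_circle_notin_finite:
  assumes "finite V"
  shows "AE y in circle_measure. y \<notin> V"
proof -
  have neq: "AE y in circle_measure. y \<noteq> v" for v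
  proof -
    have "AE \<theta> in lborel. \<theta> \<notin> {\<theta> \<in> {0..2 * pi}. cis \<theta> = v}"
    proof (rule AE_not_in, rule finite_imp_null_set_lborel, rule finite_subset)
      \<comment> \<open>The angle is unique on the half-open interval; only the right end point is counted twice.\<close>
      show "{\<theta> \<in> {0..2 * pi}. cis \<theta> = v} \<subseteq> {Arg2pi v, 2 * pi}"
      proof
        fix \<theta> assume "\<theta> \<in> {\<theta> \<in> {0..2 * pi}. cis \<theta> = v}"
        then show "\<theta> \<in> {Arg2pi v, 2 * pi}"
          using Arg2pi_unique[of 1 \<theta> v] by (cases "\<theta> = 2 * pi") (auto simp: cis_conv_exp)
      qed
    qed simp
    then show ?thesis
      unfolding circle_measure_def
      by (subst AE_distr_iff) (auto intro!: measurable_cis_uniform AE_uniform_measureI)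
  qed
  show ?thesis
    using assms by (induction V rule: finite_induct) (auto simp: neq)
qed

section \<open>Generic points of the torus\<close>

interpretation circle: product_sigma_finite "\<lambda>_::nat. circle_measure"
  using prob_space_circle
  by (simp add: product_sigma_finite_def prob_space_imp_sigma_finite)

abbreviation circles :: "nat set \<Rightarrow> (nat \<Rightarrow> complex) measure" where
  "circles J \<equiv> Pi\<^sub>M J (\<lambda>_. circle_measure)"

lemma prob_space_circles: "prob_space (circles J)"
  by (intro prob_space_PiM prob_space_circle)

text \<open>Tonelli, in the form needed to add one coordinate at a time in an induction.\<close>
lemma AE_circles_insert:
  assumes J: "finite J" "i \<notin> J"
    and [measurable]: "Measurable.pred (circles (insert i J)) P"
    and AE: "AE x in circles J. AE y in circle_measure. P (x(i := y))"
  shows "AE x in circles (insert i J). P x"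
proof -
  have "(\<integral>\<^sup>+x. indicator {x. \<not> P x} x \<partial>circles (insert i J)) =
      (\<integral>\<^sup>+x. \<integral>\<^sup>+y. indicator {x. \<not> P x} (x(i := y)) \<partial>circle_measure \<partial>circles J)"
    using J by (rule circle.product_nn_integral_insert) measurable
  also have "\<dots> = (\<integral>\<^sup>+x. 0 \<partial>circles J)"
  proof (rule nn_integral_cong_AE)
    show "AE x in circles J. (\<integral>\<^sup>+y. indicator {x. \<not> P x} (x(i := y)) \<partial>circle_measure) = 0"
      using AE
    proof eventually_elim
      case (elim x)
      have "(\<integral>\<^sup>+y. indicator {x. \<not> P x} (x(i := y)) \<partial>circle_measure) = (\<integral>\<^sup>+y. 0 \<partial>circle_measure)"
        using elim by (intro nn_integral_cong_AE) (auto elim!: eventually_mono)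
      then show ?case by simp
    qed
  qed
  finally have "(\<integral>\<^sup>+x. indicator {x. \<not> P x} x \<partial>circles (insert i J)) = 0"
    by simp
  moreover have "(\<lambda>x. indicator {x. \<not> P x} x :: ennreal) \<in> borel_measurable (circles (insert i J))"
    by measurable
  ultimately have "AE x in circles (insert i J). indicator {x. \<not> P x} x = (0::ennreal)"
    using nn_integral_0_iff_AE by blast
  then show ?thesis
    by eventually_elim (auto simp: indicator_def split: if_splits)
qed

text \<open>A letter \<open>k\<close> stands for the argument \<open>inverse_pairs x k\<close>, that is for \<open>x (k div 2)\<close> or its inverse;
\<open>letters J\<close> are the letters that belong to the variables with index in \<open>J\<close>.  Variables are integrated
out in an order that depends on the ordering of the letters, so index sets \<open>J\<close> are arbitrary
finite sets rather than initial segments.\<close>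
definition letters :: "nat set \<Rightarrow> nat set" where
  "letters J = {k. k div 2 \<in> J}"

definition partner :: "nat \<Rightarrow> nat" where
  "partner k = (if even k then k + 1 else k - 1)"

lemma letters_conv_UN: "letters J = (\<Union>j\<in>J. {2 * j, 2 * j + 1})"
  by (auto simp: letters_def)

lemma letters_lessThan: "letters {..<n} = {..<2 * n}"
  by (auto simp: letters_def)

lemma letters_empty [simp]: "letters {} = {}"
  by (simp add: letters_def)

lemma finite_letters [simp]: "finite J \<Longrightarrow> finite (letters J)"
  by (simp add: letters_conv_UN)

lemma partner_div2 [simp]: "partner k div 2 = k div 2"
  by (auto simp: partner_def elim!: oddE)

lemma partner_neq [simp]: "partner k \<noteq> k"
  by (auto simp: partner_def elim!: oddE)

lemma partner_partner [simp]: "partner (partner k) = k"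
  by (auto simp: partner_def elim!: oddE)

lemma partner_in_letters [simp]: "partner k \<in> letters J \<longleftrightarrow> k \<in> letters J"
  by (simp add: letters_def)

lemma div2_eq_iff: "k div 2 = a div 2 \<longleftrightarrow> k = a \<or> k = partner a" for a k :: nat
  by (auto simp: partner_def elim!: oddE)

lemma letters_insert: "letters (insert (a div 2) J) = insert a (insert (partner a) (letters J))"
  using div2_eq_iff by (auto simp: letters_def)

lemma card_letters: "finite J \<Longrightarrow> card (letters J) = 2 * card J"
proof (induction J rule: finite_induct)
  case (insert j J)
  have "2 * j \<notin> letters J" "partner (2 * j) \<notin> letters J"
    using insert by (auto simp: letters_def)
  moreover have "2 * j \<noteq> partner (2 * j)"
    by (metis partner_neq)
  ultimately show ?case
    using letters_insert[of "2 * j" J] insert by simp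
qed simp

lemma inverse_pairs_partner: "inverse_pairs x (partner k) = inverse (inverse_pairs x k)"
  by (auto simp: inverse_pairs_def partner_def elim!: oddE)

text \<open>At such points no denominator of the symmetrization formula vanishes: injectivity on all letters
excludes \<open>x\<^sub>i = x\<^sub>j\<close>, \<open>x\<^sub>i x\<^sub>j = 1\<close> and \<open>x\<^sub>i^2 = 1\<close> at once.\<close>
definition generic :: "nat set \<Rightarrow> (nat \<Rightarrow> complex) \<Rightarrow> bool" where
  "generic J x \<longleftrightarrow> (\<forall>j\<in>J. norm (x j) = 1) \<and> inj_on (inverse_pairs x) (letters J)"

lemma norm_inverse_pairs: "generic J x \<Longrightarrow> k \<in> letters J \<Longrightarrow> norm (inverse_pairs x k) = 1"
  by (auto simp: generic_def letters_def inverse_pairs_def norm_inverse)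

lemma inverse_pairs_upd: "k div 2 \<noteq> i \<Longrightarrow> inverse_pairs (x(i := y)) k = inverse_pairs x k"
  by (simp add: inverse_pairs_def)

lemma generic_insert:
  assumes x: "generic J x" "i \<notin> J" and y: "norm y = 1" "y \<notin> {1, - 1} \<union> inverse_pairs x ` letters J"
  shows "generic (insert i J) (x(i := y))"
proof -
  let ?z = "inverse_pairs (x(i := y))"
  have z: "?z k = inverse_pairs x k" if "k \<in> letters J" for k
    using that x(2) by (intro inverse_pairs_upd) (auto simp: letters_def)
  have z2: "?z (2 * i) = y" "?z (partner (2 * i)) = inverse y"
    by (simp_all add: inverse_pairs_partner) (simp_all add: inverse_pairs_def)
  have "y \<noteq> 0" using y by auto
  have ninv: "inverse y \<notin> inverse_pairs x ` letters J"
  proof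
    assume "inverse y \<in> inverse_pairs x ` letters J"
    then obtain k where k: "k \<in> letters J" "inverse y = inverse_pairs x k" by auto
    then have "y = inverse_pairs x (partner k)"
      by (metis inverse_inverse_eq inverse_pairs_partner)
    then show False using y k by auto
  qed
  have "y \<noteq> inverse y"
  proof
    assume "y = inverse y"
    then have "y * y = 1" using \<open>y \<noteq> 0\<close> by (metis right_inverse)
    then show False using y by (simp add: square_eq_1_iff)
  qed
  moreover have "inj_on ?z (letters J)"
    using x(1) z by (simp add: generic_def cong: inj_on_cong)
  moreover have "?z ` letters J = inverse_pairs x ` letters J"
    using z by simp
  ultimately have "inj_on ?z (insert (2 * i) (insert (partner (2 * i)) (letters J)))"
    using ninv y z2 by (auto simp: inj_on_insert)
  then show ?thesis
    using x y letters_insert[of "2 * i" J] by (auto simp: generic_def)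
qed

lemma measurable_coordinate:
  assumes "j \<in> J"
  shows "(\<lambda>x. x j) \<in> borel_measurable (circles J)"
  using measurable_component_singleton[of j J "\<lambda>_. circle_measure"] assms
  by (simp cong: measurable_cong_sets)

lemma measurable_inverse_pairs [measurable (raw)]:
  assumes "k \<in> letters J"
  shows "(\<lambda>x. inverse_pairs x k) \<in> borel_measurable (circles J)"
proof -
  have [measurable]: "(\<lambda>x. x (k div 2)) \<in> borel_measurable (circles J)"
    using assms by (intro measurable_coordinate) (simp add: letters_def)
  show ?thesis
    unfolding inverse_pairs_def by measurable
qed

lemma pred_equal:
  fixes f g :: "_ \<Rightarrow> 'c :: {second_countable_topology, t2_space}"
  shows "f \<in> borel_measurable M \<Longrightarrow> g \<in> borel_measurable M \<Longrightarrow> Measurable.pred M (\<lambda>x. f x = g x)"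
  unfolding pred_def by (rule measurable_equality_set)

text \<open>By induction on the index set: once the other coordinates are fixed, only finitely many values of
the new one are excluded.\<close>
lemma AE_generic: "finite J \<Longrightarrow> AE x in circles J. generic J x"
proof (induction J rule: finite_induct)
  case empty
  then show ?case by (simp add: generic_def)
next
  case (insert i J)
  show ?case
  proof (rule AE_circles_insert[OF insert.hyps])
    let ?M = "circles (insert i J)"
    have "Measurable.pred ?M (\<lambda>x. norm (x j) = 1)" if "j \<in> insert i J" for j
      using that by (intro pred_equal borel_measurable_norm measurable_coordinate) auto
    moreover have "Measurable.pred ?M (\<lambda>x. inverse_pairs x k = inverse_pairs x l)"
      if "k \<in> letters (insert i J)" "l \<in> letters (insert i J)" for k l
      using that by (intro pred_equal measurable_inverse_pairs) auto
    moreover have "finite (letters (insert i J))" using insert by simp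
    ultimately show "Measurable.pred ?M (generic (insert i J))"
      unfolding generic_def inj_on_def using insert(1)
      by (intro pred_intros_logic pred_intros_finite) auto
    show "AE x in circles J. AE y in circle_measure. generic (insert i J) (x(i := y))"
      using insert.IH
    proof eventually_elim
      case (elim x)
      have "finite ({1, - 1} \<union> inverse_pairs x ` letters J)"
        using insert by simp
      from AE_circle_norm AE_circle_notin_finite[OF this] show ?case
        by eventually_elim (rule generic_insert[OF elim insert(2)])
    qed
  qed
qed

section \<open>Sums over orderings\<close>

fun pair_prod :: "('a \<Rightarrow> 'a \<Rightarrow> 'b :: comm_monoid_mult) \<Rightarrow> 'a list \<Rightarrow> 'b" where
  "pair_prod f [] = 1"
| "pair_prod f (a # ws) = (\<Prod>b\<leftarrow>ws. f a b) * pair_prod f ws"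

lemma pair_prod_conv_nth:
  "pair_prod f ws = (\<Prod>j<length ws. \<Prod>i<j. f (ws ! i) (ws ! j))"
proof (induction ws)
  case (Cons a ws)
  have "(\<Prod>b\<leftarrow>ws. f a b) = (\<Prod>j<length ws. f a (ws ! j))"
    by (simp add: prod.list_conv_set_nth atLeast0LessThan)
  then show ?case
    using Cons.IH by (simp add: prod.lessThan_Suc_shift prod.distrib del: prod.lessThan_Suc)
qed simp

lemma pair_prod_insert:
  "pair_prod f (A @ c # B) = (\<Prod>b\<leftarrow>A. f b c) * (\<Prod>b\<leftarrow>B. f c b) * pair_prod f (A @ B)"
  by (induction A) (simp_all add: mult_ac)

lemma sum_permutations_of_set_Cons:
  assumes "finite S" "S \<noteq> {}"
  shows "(\<Sum>ws\<in>permutations_of_set S. F ws) =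
    (\<Sum>a\<in>S. \<Sum>us\<in>permutations_of_set (S - {a}). F (a # us))"
  unfolding permutations_of_set_nonempty[OF assms(2)]
  using assms(1)
  by (subst sum.UNION_disjoint) (auto simp: sum.reindex inj_on_def)

text \<open>An ordering of \<open>insert b S\<close> is an ordering of \<open>S\<close> together with the position at which \<open>b\<close> is inserted.\<close>
lemma sum_permutations_of_set_insert:
  assumes "finite S" "b \<notin> S"
  shows "(\<Sum>ws\<in>permutations_of_set (insert b S). F ws) =
    (\<Sum>p\<le>card S. \<Sum>us\<in>permutations_of_set S. F (take p us @ b # drop p us))"
proof -
  have "(\<Sum>p\<le>card S. \<Sum>us\<in>permutations_of_set S. F (take p us @ b # drop p us)) =
      (\<Sum>(p, us)\<in>{..card S} \<times> permutations_of_set S. F (take p us @ b # drop p us))"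
    by (simp add: sum.cartesian_product)
  also have "\<dots> = (\<Sum>ws\<in>permutations_of_set (insert b S). F ws)"
  proof (rule sum.reindex_bij_witness[where
        i = "\<lambda>ws. (length (takeWhile (\<lambda>c. c \<noteq> b) ws), removeAll b ws)" and
        j = "\<lambda>(p, us). take p us @ b # drop p us"], goal_cases)
    case (1 pus)
    then obtain p us where pus: "pus = (p, us)" "p \<le> length us" "distinct us" "set us = S"
      by (auto simp: permutations_of_set_def distinct_card)
    have nb: "b \<notin> set (take p us)" "b \<notin> set (drop p us)"
      using pus assms by (auto dest: in_set_takeD in_set_dropD)
    have "takeWhile (\<lambda>c. c \<noteq> b) (take p us @ b # drop p us) = take p us"
      using nb by (subst takeWhile_append2) auto
    moreover have "removeAll b (take p us @ b # drop p us) = us"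
      using nb by simp
    ultimately show ?case using pus by simp
  next
    case (2 pus)
    then obtain p us where pus: "pus = (p, us)" "p \<le> length us" "distinct us" "set us = S"
      by (auto simp: permutations_of_set_def distinct_card)
    have "distinct (take p us @ drop p us)" "set (take p us @ drop p us) = S"
      using pus by simp_all
    then have "distinct (take p us @ b # drop p us)" "set (take p us @ b # drop p us) = insert b S"
      using assms(2) by (auto simp del: append_take_drop_id)
    then show ?case using pus by (simp add: permutations_of_set_def)
  next
    case (3 ws)
    then have "b \<in> set ws" "distinct ws" by (auto simp: permutations_of_set_def)
    then obtain A B where ws: "ws = A @ b # B" by (meson split_list)
    have nb: "b \<notin> set A" "b \<notin> set B" using \<open>distinct ws\<close> ws by auto
    then have "takeWhile (\<lambda>c. c \<noteq> b) ws = A"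
      unfolding ws by (subst takeWhile_append2) auto
    then show ?case using nb ws by simp
  next
    case (4 ws)
    then have "b \<in> set ws" "distinct ws" and S: "set ws = insert b S"
      by (auto simp: permutations_of_set_def)
    then obtain A B where ws: "ws = A @ b # B" by (meson split_list)
    have nb: "b \<notin> set A" "b \<notin> set B" using \<open>distinct ws\<close> ws by auto
    then have tw: "takeWhile (\<lambda>c. c \<noteq> b) ws = A"
      unfolding ws by (subst takeWhile_append2) auto
    have "distinct (A @ B)" "set (A @ B) = S"
      using \<open>distinct ws\<close> S ws nb assms(2) by auto
    moreover from this have "length A \<le> card S"
      by (metis distinct_card length_append le_add1)
    ultimately show ?case using nb ws tw by (simp add: permutations_of_set_def)
  qed auto
  finally show ?thesis by simp
qed

lemma sum_permutes_conv_permutations_of_set: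
  "(\<Sum>w | w permutes {..<N}. F (map w [0..<N])) = (\<Sum>ws\<in>permutations_of_set {..<N}. F ws)"
proof (rule sum.reindex_bij_witness[where i = "\<lambda>ws k. if k < N then ws ! k else k" and
      j = "\<lambda>w. map w [0..<N]"], goal_cases)
  case (1 w)
  then show ?case by (auto simp: permutes_def)
next
  case (2 w)
  then have "inj_on w {..<N}" "w ` {..<N} = {..<N}"
    by (auto simp: permutes_image intro: inj_on_subset[OF permutes_inj])
  then show ?case by (simp add: permutations_of_set_def distinct_map atLeast0LessThan)
next
  case (3 ws)
  then have "length ws = N" by (simp add: length_finite_permutations_of_set)
  then show ?case by (auto intro: nth_equalityI)
next
  case (4 ws)
  then have ws: "length ws = N" "distinct ws" "set ws = {..<N}"
    by (auto simp: permutations_of_set_def length_finite_permutations_of_set)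
  have "bij_betw (\<lambda>k. if k < N then ws ! k else k) {..<N} {..<N} =
      bij_betw ((!) ws) {..<N} {..<N}"
    by (rule bij_betw_cong) simp
  then have "bij_betw (\<lambda>k. if k < N then ws ! k else k) {..<N} {..<N}"
    using bij_betw_nth[OF ws(2)] ws(1,3) by blast
  then have "(\<lambda>k. if k < N then ws ! k else k) permutes {..<N}"
    by (rule bij_imp_permutes) simp
  then show ?case by simp
qed auto

section \<open>The Hall-Littlewood polynomial of the zero partition\<close>

lemma monic_prod_linear:
  fixes c :: "'a \<Rightarrow> complex"
  assumes "finite S"
  shows "degree (\<Prod>b\<in>S. [:- c b, 1:]) = card S \<and> coeff (\<Prod>b\<in>S. [:- c b, 1:]) (card S) = 1"
  using assms
proof (induction S rule: finite_induct)
  case (insert a S)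
  have "(\<Prod>b\<in>S. [:- c b, 1:]) \<noteq> 0"
    using insert.hyps by (simp)
  then have "degree (\<Prod>b\<in>insert a S. [:- c b, 1:]) = Suc (card S)"
    using insert by (simp add: degree_mult_eq del: mult_pCons_left)
  moreover have "coeff (\<Prod>b\<in>insert a S. [:- c b, 1:]) (Suc (card S)) = 1"
    using insert by (simp add: coeff_eq_0)
  ultimately show ?case using insert by simp
qed simp

text \<open>The left-hand side is the leading coefficient of the Lagrange interpolation polynomial of \<open>g\<close> on the
points \<open>z a\<close>, which is \<open>g\<close> itself because its degree is small.\<close>
lemma sum_divided_difference_eq_coeff:
  fixes z :: "'a \<Rightarrow> complex"
  assumes S: "finite S" "inj_on z S" and g: "degree g < card S"
  shows "(\<Sum>a\<in>S. poly g (z a) / (\<Prod>b\<in>S - {a}. z a - z b)) = coeff g (card S - 1)"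
proof -
  define c where "c a = poly g (z a) / (\<Prod>b\<in>S - {a}. z a - z b)" for a
  define q where "q = (\<Sum>a\<in>S. smult (c a) (\<Prod>b\<in>S - {a}. [:- z b, 1:]))"
  have mon: "degree (\<Prod>b\<in>S - {a}. [:- z b, 1:]) = card S - 1"
    "coeff (\<Prod>b\<in>S - {a}. [:- z b, 1:]) (card S - 1) = 1" if "a \<in> S" for a
    using monic_prod_linear[of "S - {a}" z] S that by auto
  have "degree q \<le> card S - 1"
    unfolding q_def using S mon by (intro degree_sum_le) (auto intro: order.trans[OF degree_smult_le])
  moreover have "poly q (z a) = poly g (z a)" if a: "a \<in> S" for a
  proof -
    have "poly q (z a) = (\<Sum>e\<in>S. c e * (\<Prod>b\<in>S - {e}. z a - z b))"
      by (simp add: q_def poly_sum poly_prod)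
    also have "\<dots> = (\<Sum>e\<in>{a}. c e * (\<Prod>b\<in>S - {e}. z a - z b))"
      using S a by (intro sum.mono_neutral_right) auto
    also have "\<dots> = poly g (z a)"
      using S a by (auto simp: c_def prod_zero_iff inj_on_def)
    finally show ?thesis .
  qed
  ultimately have "g = q"
    using g S by (intro poly_eqI_degree[of "z ` S"]) (auto simp: card_image)
  then have "coeff g (card S - 1) = (\<Sum>a\<in>S. c a * coeff (\<Prod>b\<in>S - {a}. [:- z b, 1:]) (card S - 1))"
    by (simp add: q_def coeff_sum)
  also have "\<dots> = (\<Sum>a\<in>S. c a)"
    using mon by simp
  finally show ?thesis by (simp add: c_def)
qed

text \<open>Up to the factor \<open>1 - t\<close>, the numerators are the values at \<open>z a\<close> of the polynomial
\<open>g(X) = (\<Prod>\<^sub>b (X - t z\<^sub>b) - t^N \<Prod>\<^sub>b (X - z\<^sub>b)) / X\<close>: the second product vanishes at every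
\<open>z a\<close>, and the multiple \<open>t^N\<close> of it is what makes the numerator divisible by \<open>X\<close>.  The leading coefficient
of \<open>g\<close> is \<open>1 - t^N\<close>.\<close>
lemma sum_prod_t_quotients:
  fixes z :: "'a \<Rightarrow> complex"
  assumes S: "finite S" "inj_on z S" and nz: "\<And>a. a \<in> S \<Longrightarrow> z a \<noteq> 0" and t: "t \<noteq> 1"
  shows "(\<Sum>a\<in>S. \<Prod>b\<in>S - {a}. (z a - t * z b) / (z a - z b)) = (1 - t ^ card S) / (1 - t)"
proof (cases "S = {}")
  case False
  define N where "N = card S"
  have N: "N > 0" using S False by (simp add: N_def card_gt_0_iff)
  define r where "r = (\<Prod>b\<in>S. [:- (t * z b), 1:]) - smult (t ^ N) (\<Prod>b\<in>S. [:- z b, 1:])"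
  define g where "g = poly_shift 1 r"
  have "poly r 0 = 0"
    by (simp add: r_def poly_prod N_def flip: prod_constant prod.distrib)
  then have r: "r = pCons 0 g"
    unfolding g_def by (cases r) (auto simp: poly_eq_iff coeff_poly_shift coeff_pCons split: nat.splits)
  have "degree r \<le> N"
    unfolding r_def N_def using monic_prod_linear[OF S(1), of z] monic_prod_linear[OF S(1), of "\<lambda>b. t * z b"]
    by (intro degree_diff_le order.trans[OF degree_smult_le]) auto
  moreover have "coeff r N = 1 - t ^ N"
    unfolding r_def N_def using monic_prod_linear[OF S(1), of z] monic_prod_linear[OF S(1), of "\<lambda>b. t * z b"]
    by simp
  ultimately have g: "degree g < card S" "coeff g (card S - 1) = 1 - t ^ N"
    using N unfolding r N_def[symmetric] by (auto simp: coeff_pCons split: nat.splits if_splits)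
  have val: "poly g (z a) = (1 - t) * (\<Prod>b\<in>S - {a}. z a - t * z b)" if a: "a \<in> S" for a
  proof -
    have "z a * poly g (z a) = poly r (z a)" unfolding r by simp
    also have "\<dots> = (\<Prod>b\<in>S. z a - t * z b)"
      using S a by (auto simp: r_def poly_prod intro!: prod_zero)
    also have "\<dots> = z a * ((1 - t) * (\<Prod>b\<in>S - {a}. z a - t * z b))"
      using S a by (subst prod.remove[of S a]) (auto simp: algebra_simps)
    finally show ?thesis using nz[OF a] by simp
  qed
  have "(1 - t) * (\<Sum>a\<in>S. \<Prod>b\<in>S - {a}. (z a - t * z b) / (z a - z b)) =
      (\<Sum>a\<in>S. poly g (z a) / (\<Prod>b\<in>S - {a}. z a - z b))"
    by (simp add: sum_distrib_left val prod_dividef)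
  also have "\<dots> = 1 - t ^ N"
    using sum_divided_difference_eq_coeff[OF S g(1)] g(2) by simp
  finally show ?thesis using t by (simp add: N_def field_simps)
qed simp

text \<open>The factors of the first letter of an ordering do not depend on how the others are ordered, so
\<open>sum_prod_t_quotients\<close> splits off one factor of the right-hand side at a time.\<close>
lemma sum_permutations_t_quotients:
  fixes z :: "'a \<Rightarrow> complex"
  assumes "finite S" "inj_on z S" "\<And>a. a \<in> S \<Longrightarrow> z a \<noteq> 0" "t \<noteq> 1"
  shows "(\<Sum>ws\<in>permutations_of_set S. pair_prod (\<lambda>a b. (z a - t * z b) / (z a - z b)) ws) =
    (\<Prod>j=1..card S. (1 - t ^ j) / (1 - t))"
  using assms
proof (induction "card S" arbitrary: S)
  case (Suc N)
  let ?f = "\<lambda>a b. (z a - t * z b) / (z a - z b)"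
  have ne: "S \<noteq> {}" using Suc.hyps(2) by auto
  have "(\<Sum>ws\<in>permutations_of_set S. pair_prod ?f ws) =
      (\<Sum>a\<in>S. \<Sum>us\<in>permutations_of_set (S - {a}). (\<Prod>b\<in>S - {a}. ?f a b) * pair_prod ?f us)"
    unfolding sum_permutations_of_set_Cons[OF Suc.prems(1) ne]
    by (intro sum.cong refl)
      (auto simp: permutations_of_set_def simp flip: prod.distinct_set_conv_list)
  also have "\<dots> = (\<Sum>a\<in>S. (\<Prod>b\<in>S - {a}. ?f a b) * (\<Prod>j=1..N. (1 - t ^ j) / (1 - t)))"
  proof (rule sum.cong[OF refl])
    fix a assume a: "a \<in> S"
    have "(\<Sum>us\<in>permutations_of_set (S - {a}). pair_prod ?f us) =
        (\<Prod>j=1..card (S - {a}). (1 - t ^ j) / (1 - t))"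
      using Suc.hyps(2) Suc.prems a
      by (intro Suc.hyps(1)) (auto intro: inj_on_subset)
    moreover have "card (S - {a}) = N"
      using Suc.hyps(2) Suc.prems a by simp
    ultimately show "(\<Sum>us\<in>permutations_of_set (S - {a}). (\<Prod>b\<in>S - {a}. ?f a b) * pair_prod ?f us) =
        (\<Prod>b\<in>S - {a}. ?f a b) * (\<Prod>j=1..N. (1 - t ^ j) / (1 - t))"
      by (simp flip: sum_distrib_left)
  qed
  also have "\<dots> = (\<Prod>j=1..Suc N. (1 - t ^ j) / (1 - t))"
    using sum_prod_t_quotients[OF Suc.prems(1-4)] Suc.hyps(2)[symmetric]
    by (simp flip: sum_distrib_right)
  finally show ?case using Suc.hyps(2) by simp
qed simp

section \<open>Matchings of positions that carry equal parts\<close>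

text \<open>The generating function of the perfect matchings of \<open>k\<close> points on a line, each weighted by \<open>t\<close> to the
number of its crossings plus twice the number of its nestings.  The recursion removes the first
point and its partner: among the \<open>p\<close> points between the two, every pair that crosses this one has one
point and every pair nested in it has two.\<close>
fun matching_poly :: "complex \<Rightarrow> nat \<Rightarrow> complex" where
  "matching_poly t 0 = 1"
| "matching_poly t (Suc 0) = 0"
| "matching_poly t (Suc (Suc k)) = (\<Sum>p\<le>k. t ^ p) * matching_poly t k"

text \<open>For a decreasing list, the same generating function restricted to matchings of positions with equal
entries.  Equal entries are adjacent, so points between two matched positions carry the same
entry, and the matchings of different entries are independent.\<close>
definition multiset_matching_poly :: "complex \<Rightarrow> nat list \<Rightarrow> complex" where
  "multiset_matching_poly t ls = (\<Prod>v\<in>set ls. matching_poly t (count_list ls v))"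

lemma matching_poly_odd: "odd k \<Longrightarrow> matching_poly t k = 0"
  by (induction t k rule: matching_poly.induct) auto

lemma matching_poly_even:
  assumes "t \<noteq> 1"
  shows "matching_poly t (2 * k) = (\<Prod>j=1..k. (1 - t ^ (2 * j - 1)) / (1 - t))"
proof (induction k)
  case (Suc k)
  have "matching_poly t (2 * Suc k) = (\<Sum>p<Suc (2 * k). t ^ p) * matching_poly t (2 * k)"
    by (simp add: lessThan_Suc_atMost)
  also have "(\<Sum>p<Suc (2 * k). t ^ p) = (1 - t ^ (2 * Suc k - 1)) / (1 - t)"
    using assms by (subst sum_gp_strict) simp
  finally show ?case using Suc by (simp add: mult.commute)
qed simp

lemma multiset_matching_poly_superset:
  assumes "finite V" "set ls \<subseteq> V"
  shows "multiset_matching_poly t ls = (\<Prod>v\<in>V. matching_poly t (count_list ls v))"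
  unfolding multiset_matching_poly_def using assms
  by (intro prod.mono_neutral_left) (auto simp: count_list_0_iff)

lemma positions_of_maximum:
  fixes l :: nat
  assumes "sorted_wrt (\<ge>) (l # ls)"
  shows "{p. p < length ls \<and> ls ! p = l} = {..<count_list ls l}"
  using assms
proof (induction ls)
  case (Cons a ls)
  show ?case
  proof (cases "a = l")
    case True
    have "{p. p < length (a # ls) \<and> (a # ls) ! p = l} =
        insert 0 (Suc ` {p. p < length ls \<and> ls ! p = l})"
      using True by (auto simp: image_iff less_Suc_eq_0_disj)
    also have "\<dots> = {..<Suc (count_list ls l)}"
      using Cons by (simp add: lessThan_Suc_eq_insert_0)
    finally show ?thesis using True by simp
  next
    case False
    then have "\<forall>b\<in>set (a # ls). b < l" using Cons.prems by fastforce
    then have "l \<notin> set (a # ls)" by blast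
    then have "count_list (a # ls) l = 0" "{p. p < length (a # ls) \<and> (a # ls) ! p = l} = {}"
      using nth_mem[of _ "a # ls"] by (auto simp only: count_list_0_iff)
    then show ?thesis by (simp only: lessThan_0)
  qed
qed simp

text \<open>In a decreasing list \<open>l # ls\<close> the candidates for the partner of the first position are the initial
positions of \<open>ls\<close>, as many as \<open>ls\<close> has entries \<open>l\<close>.  Removing any of them leaves the same multiset.\<close>
lemma multiset_matching_poly_Cons:
  assumes "sorted_wrt (\<ge>) (l # ls)"
  shows "multiset_matching_poly t (l # ls) =
    (\<Sum>p<length ls. if ls ! p = l
       then t ^ p * multiset_matching_poly t (take p ls @ drop (Suc p) ls) else 0)"
proof -
  define V where "V = set (l # ls)"
  define c where "c = count_list ls l"
  define R where "R = (\<Prod>v\<in>V - {l}. matching_poly t (count_list ls v))"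
  have V: "finite V" "l \<in> V" by (simp_all add: V_def)
  have rem: "multiset_matching_poly t (take p ls @ drop (Suc p) ls) = matching_poly t (c - 1) * R"
    if p: "p < length ls" "ls ! p = l" for p
  proof -
    have cnt: "count_list ls v = count_list (take p ls @ l # drop (Suc p) ls) v" for v
      using id_take_nth_drop[OF p(1)] p(2) by simp
    have "set (take p ls @ drop (Suc p) ls) \<subseteq> V"
      by (auto simp: V_def dest: in_set_takeD in_set_dropD)
    then have "multiset_matching_poly t (take p ls @ drop (Suc p) ls) =
        (\<Prod>v\<in>V. matching_poly t (count_list (take p ls @ drop (Suc p) ls) v))"
      using V by (intro multiset_matching_poly_superset)
    also have "\<dots> = matching_poly t (c - 1) * R"
      unfolding prod.remove[OF V] R_def c_def cnt
      by (intro arg_cong2[where f = "(*)"] prod.cong) auto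
    finally show ?thesis .
  qed
  have "(\<Sum>p<length ls. if ls ! p = l
       then t ^ p * multiset_matching_poly t (take p ls @ drop (Suc p) ls) else 0) =
      (\<Sum>p<length ls. if ls ! p = l then t ^ p * (matching_poly t (c - 1) * R) else 0)"
    by (intro sum.cong refl) (simp add: rem)
  also have "\<dots> = (\<Sum>p\<in>{..<c}. t ^ p * (matching_poly t (c - 1) * R))"
    using positions_of_maximum[OF assms]
    by (simp add: sum.If_cases c_def Int_def conj_commute)
  also have "\<dots> = matching_poly t (Suc c) * R"
    unfolding sum_distrib_right[symmetric]
    by (cases c) (simp_all add: lessThan_Suc_atMost)
  also have "\<dots> = multiset_matching_poly t (l # ls)"
    unfolding multiset_matching_poly_def V_def[symmetric] prod.remove[OF V] R_def c_def
    by (intro arg_cong2[where f = "(*)"] prod.cong) auto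
  finally show ?thesis by simp
qed

section \<open>Words and the density\<close>

definition monomial_word :: "('a \<Rightarrow> complex) \<Rightarrow> nat list \<Rightarrow> 'a list \<Rightarrow> complex" where
  "monomial_word z ls ws = (\<Prod>(l, a)\<leftarrow>zip ls ws. z a ^ l)"

text \<open>The summand of the symmetrization formula that belongs to the ordering \<open>ws\<close> of the letters.\<close>
definition hl_word :: "complex \<Rightarrow> (nat \<Rightarrow> complex) \<Rightarrow> nat list \<Rightarrow> nat list \<Rightarrow> complex" where
  "hl_word t z ls ws =
     monomial_word z ls ws * pair_prod (\<lambda>a b. (z a - t * z b) / (z a - z b)) ws"

text \<open>The density factor of two variables consists of four numerators and four denominators.  It is split
here into two halves, one for each of the letters \<open>u\<close> and \<open>1/u\<close>, so that the density becomes a product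
over letters like the summands of the symmetrization formula.\<close>
definition cross_factor :: "complex \<Rightarrow> complex \<Rightarrow> complex \<Rightarrow> complex" where
  "cross_factor t y u = (1 - y * u) * (1 - inverse y * u) / ((1 - t * y * u) * (1 - t * inverse y * u))"

definition diag_factor :: "complex \<Rightarrow> complex \<Rightarrow> complex" where
  "diag_factor t y = (1 - y\<^sup>2) * (1 - (inverse y)\<^sup>2) / ((1 - t * y\<^sup>2) * (1 - t * (inverse y)\<^sup>2))"

definition density_on :: "complex \<Rightarrow> nat set \<Rightarrow> (nat \<Rightarrow> complex) \<Rightarrow> complex" where
  "density_on t J x = (\<Prod>i\<in>J. diag_factor t (x i)) *
     (\<Prod>j\<in>J. \<Prod>i\<in>{i \<in> J. i < j}. cross_factor t (x i) (x j) * cross_factor t (x i) (inverse (x j)))"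

lemma koornwinder_density_eq:
  assumes "sqrt_t ^ 2 = t"
  shows "koornwinder_density n sqrt_t (- sqrt_t) 0 0 t x =
    1 / (2 ^ n * fact n) * density_on t {..<n} x"
proof -
  have sq: "(1 - sqrt_t * y) * (1 + sqrt_t * y) = 1 - t * y\<^sup>2" for y
    by (simp add: assms[symmetric] algebra_simps power2_eq_square)
  have 1: "prod_pm (\<lambda>y. 1 - y\<^sup>2) y /
        (prod_pm (\<lambda>y. 1 - sqrt_t * y) y * prod_pm (\<lambda>y. 1 - (- sqrt_t) * y) y *
         prod_pm (\<lambda>y. 1 - 0 * y) y * prod_pm (\<lambda>y. 1 - 0 * y) y) = diag_factor t y" for y
  proof -
    have "prod_pm (\<lambda>y. 1 - sqrt_t * y) y * prod_pm (\<lambda>y. 1 - (- sqrt_t) * y) y =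
        ((1 - sqrt_t * y) * (1 + sqrt_t * y)) * ((1 - sqrt_t * inverse y) * (1 + sqrt_t * inverse y))"
      by (simp add: prod_pm_def mult_ac)
    then show ?thesis
      unfolding sq by (simp add: diag_factor_def prod_pm_def)
  qed
  have 2: "prod_pm (\<lambda>y. prod_pm (\<lambda>u. 1 - y * u) u) y / prod_pm (\<lambda>y. prod_pm (\<lambda>u. 1 - t * y * u) u) y =
      cross_factor t y u * cross_factor t y (inverse u)" for y u
    by (simp add: prod_pm_def cross_factor_def mult_ac)
  have 3: "(\<Prod>j\<in>{..<n}. \<Prod>i\<in>{i \<in> {..<n}. i < j}. g i j) = (\<Prod>j<n. \<Prod>i<j. g i j)"
    for g :: "nat \<Rightarrow> nat \<Rightarrow> complex"
    by (intro prod.cong) auto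
  show ?thesis
    unfolding koornwinder_density_def 1 2 density_on_def 3 by (simp only: mult.assoc)
qed

lemma cross_factor_pair_commute:
  "cross_factor t y u * cross_factor t y (inverse u) = cross_factor t u y * cross_factor t u (inverse y)"
  by (simp add: cross_factor_def mult_ac)

lemma cross_factor_inverse: "cross_factor t (inverse y) u = cross_factor t y u"
  by (simp add: cross_factor_def mult_ac)

lemma diag_factor_inverse: "diag_factor t (inverse y) = diag_factor t y"
  by (simp add: diag_factor_def mult_ac)

lemma prod_letters:
  assumes "finite J"
  shows "(\<Prod>b\<in>letters J. f (inverse_pairs x b)) = (\<Prod>j\<in>J. f (x j) * f (inverse (x j)))"
  using assms
proof (induction J rule: finite_induct)
  case (insert j J)
  have nin: "2 * j \<notin> letters J" "partner (2 * j) \<notin> letters J" "2 * j \<noteq> partner (2 * j)"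
    using insert partner_neq[of "2 * j"] by (auto simp: letters_def simp del: partner_neq)
  have "letters (insert j J) = insert (2 * j) (insert (partner (2 * j)) (letters J))"
    using letters_insert[of "2 * j" J] by simp
  moreover have "inverse_pairs x (2 * j) = x j" by (simp add: inverse_pairs_def)
  ultimately show ?case
    using nin insert by (simp add: inverse_pairs_partner mult.assoc)
qed simp

text \<open>The ordering of the indices \<open>i < j\<close> in the definition is immaterial because the factor of two
variables is symmetric.  So any variable can be split off, and it may be represented by either
of its two letters.\<close>
lemma density_on_insert:
  assumes "finite J" "a div 2 \<notin> J"
  shows "density_on t (insert (a div 2) J) x =
    diag_factor t (inverse_pairs x a) *
    (\<Prod>b\<in>letters J. cross_factor t (inverse_pairs x a) (inverse_pairs x b)) * density_on t J x"
proof -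
  let ?i = "a div 2"
  define G where "G i j = cross_factor t (x i) (x j) * cross_factor t (x i) (inverse (x j))" for i j
  have sym: "G i j = G j i" for i j
    unfolding G_def by (rule cross_factor_pair_commute)
  have row: "(\<Prod>k\<in>{k \<in> insert ?i J. k < j}. G k j) =
      (\<Prod>k\<in>{k \<in> J. k < j}. G k j) * (if ?i < j then G ?i j else 1)" for j
  proof -
    have "{k \<in> insert ?i J. k < j} = (if ?i < j then insert ?i {k \<in> J. k < j} else {k \<in> J. k < j})"
      by auto
    then show ?thesis using assms by (simp add: mult_ac)
  qed
  have "(\<Prod>k\<in>{k \<in> J. k < ?i}. G k ?i) = (\<Prod>j\<in>J. if j < ?i then G j ?i else 1)"
    using assms(1) by (simp add: prod.inter_filter)
  moreover have "(\<Prod>j\<in>J. if j < ?i then G j ?i else 1) * (\<Prod>j\<in>J. if ?i < j then G ?i j else 1) =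
      (\<Prod>j\<in>J. G ?i j)"
    unfolding prod.distrib[symmetric]
  proof (rule prod.cong[OF refl])
    fix j assume "j \<in> J"
    then have "j \<noteq> ?i" using assms(2) by auto
    then show "(if j < ?i then G j ?i else 1) * (if ?i < j then G ?i j else 1) = G ?i j"
      using sym[of j ?i] by auto
  qed
  ultimately have cross: "(\<Prod>j\<in>insert ?i J. \<Prod>k\<in>{k \<in> insert ?i J. k < j}. G k j) =
      (\<Prod>j\<in>J. G ?i j) * (\<Prod>j\<in>J. \<Prod>k\<in>{k \<in> J. k < j}. G k j)"
    unfolding row using assms by (simp add: prod.distrib mult_ac)
  have "inverse_pairs x a = x ?i \<or> inverse_pairs x a = inverse (x ?i)"
    by (simp add: inverse_pairs_def)
  then have "diag_factor t (inverse_pairs x a) = diag_factor t (x ?i)"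
    and "cross_factor t (inverse_pairs x a) u = cross_factor t (x ?i) u" for u
    by (auto simp: cross_factor_inverse diag_factor_inverse)
  then show ?thesis
    unfolding density_on_def G_def[symmetric] cross
    using assms by (simp add: prod_letters G_def mult_ac)
qed

section \<open>Integrating out the first letter of a word\<close>

text \<open>What remains of all factors that involve the first letter \<open>y\<close> of a word or its partner: \<open>us\<close> are the
letters between the two and \<open>k\<close> is the difference of their parts.\<close>
definition residual_kernel :: "complex \<Rightarrow> nat \<Rightarrow> complex list \<Rightarrow> complex \<Rightarrow> complex" where
  "residual_kernel t k us y =
     y ^ k * ((1 - y\<^sup>2) / (1 - t * y\<^sup>2)) * (\<Prod>u\<leftarrow>us. (t - y * u) / (1 - t * y * u))"

lemma one_minus_neq_0:
  fixes t y :: complex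
  assumes "norm t < 1" "norm y \<le> 1"
  shows "1 - t * y \<noteq> 0"
proof
  assume "1 - t * y = 0"
  then have "norm (t * y) = 1" by (metis eq_iff_diff_eq_0 norm_one)
  moreover have "norm (t * y) \<le> norm t * 1"
    unfolding norm_mult using assms by (intro mult_left_mono) auto
  ultimately show False using assms by simp
qed

text \<open>The factors of a letter \<open>u\<close> that stands between \<open>y\<close> and its partner.\<close>
lemma factor_before_partner:
  assumes "norm t < 1" "norm y = 1" "norm u = 1" "y \<noteq> u" "u \<noteq> inverse y"
  shows "(y - t * u) / (y - u) * ((u - t * inverse y) / (u - inverse y)) * cross_factor t y u =
    (t - y * u) / (1 - t * y * u)"
proof -
  have nz: "y \<noteq> 0" using assms by auto
  have "1 - t * (y * u) \<noteq> 0" "1 - t * (inverse y * u) \<noteq> 0"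
    using assms by (intro one_minus_neq_0; simp add: norm_mult norm_inverse)+
  moreover have "1 - y * u \<noteq> 0"
    using assms(5) nz by (auto simp: inverse_eq_divide field_simps)
  ultimately show ?thesis
    using assms(4) nz
    by (simp add: cross_factor_def divide_simps mult.assoc) (simp add: algebra_simps)
qed

text \<open>If \<open>u\<close> comes after both \<open>y\<close> and \<open>1/y\<close>, the two quotients of the symmetrization formula are exactly
the inverse of the factor in the density.\<close>
lemma factor_after_partner:
  assumes "norm t < 1" "norm y = 1" "norm u = 1" "y \<noteq> u" "u \<noteq> inverse y"
  shows "(y - t * u) / (y - u) * ((inverse y - t * u) / (inverse y - u)) * cross_factor t y u = 1"
proof -
  have nz: "y \<noteq> 0" using assms by auto
  have a: "1 - t * (y * u) \<noteq> 0" "1 - t * (inverse y * u) \<noteq> 0"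
    using assms by (intro one_minus_neq_0; simp add: norm_mult norm_inverse)+
  have b: "1 - y * u \<noteq> 0" "1 - inverse y * u \<noteq> 0"
    using assms(4,5) nz by (auto simp: inverse_eq_divide field_simps)
  have "(y - t * u) / (y - u) = (1 - t * (inverse y * u)) / (1 - inverse y * u)"
    using nz assms(4) b by (simp add: field_simps)
  moreover have "(inverse y - t * u) / (inverse y - u) = (1 - t * (y * u)) / (1 - y * u)"
    using nz assms(5) b by (simp add: field_simps)
  ultimately show ?thesis
    using a b by (simp add: cross_factor_def mult.assoc)
qed

lemma factor_partner:
  assumes "norm t < 1" "norm y = 1" "y \<noteq> inverse y"
  shows "(y - t * inverse y) / (y - inverse y) * diag_factor t y = (1 - y\<^sup>2) / (1 - t * y\<^sup>2)"
proof -
  have nz: "y \<noteq> 0" using assms by auto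
  have a: "1 - t * y\<^sup>2 \<noteq> 0" "1 - t * (inverse y)\<^sup>2 \<noteq> 0"
    using assms by (intro one_minus_neq_0; simp add: norm_power norm_inverse)+
  have b: "1 - (inverse y)\<^sup>2 \<noteq> 0"
    using assms(3) nz by (auto simp: power2_eq_square inverse_eq_divide field_simps)
  have "(y - t * inverse y) / (y - inverse y) = (1 - t * (inverse y)\<^sup>2) / (1 - (inverse y)\<^sup>2)"
    using nz assms(3) b by (simp add: field_simps power2_eq_square)
  then show ?thesis
    using a b by (simp add: diag_factor_def)
qed

lemma borel_measurable_residual_kernel: "residual_kernel t k us \<in> borel_measurable borel"
proof -
  have "(\<lambda>y. \<Prod>u\<leftarrow>us. (t - y * u) / (1 - t * y * u)) \<in> borel_measurable borel"
    by (induction us) simp_all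
  then show ?thesis
    unfolding residual_kernel_def by measurable
qed

text \<open>At \<open>y = 0\<close> each of the letters in \<open>us\<close> contributes the factor \<open>t\<close>.\<close>
lemma residual_kernel_integral:
  assumes t: "norm t < 1" and us: "\<And>u. u \<in> set us \<Longrightarrow> norm u = 1"
  shows "(LINT y|circle_measure. residual_kernel t k us y) = (if k = 0 then t ^ length us else 0)"
proof -
  have nz: "1 - t * y\<^sup>2 \<noteq> 0" "u \<in> set us \<Longrightarrow> 1 - t * y * u \<noteq> 0" if "norm y \<le> 1" for y u
    using that t us one_minus_neq_0[of t "y\<^sup>2"] one_minus_neq_0[of t "y * u"]
    by (auto simp: norm_power norm_mult power_le_one mult.assoc)
  have "(\<lambda>y. \<Prod>u\<leftarrow>vs. (t - y * u) / (1 - t * y * u)) holomorphic_on cball 0 1"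
    if "set vs \<subseteq> set us" for vs
    using that
  proof (induction vs)
    case (Cons u vs)
    have "(\<lambda>y. (t - y * u) / (1 - t * y * u)) holomorphic_on cball 0 1"
      using Cons.prems by (intro holomorphic_intros nz(2)) auto
    from holomorphic_on_mult[OF this Cons.IH] Cons.prems show ?case
      by (simp del: times_divide_eq_left times_divide_eq_right)
  qed simp
  then have hol: "residual_kernel t k us holomorphic_on cball 0 1"
    unfolding residual_kernel_def by (intro holomorphic_intros nz(1)) auto
  then have "continuous_on (cball 0 1) (residual_kernel t k us)"
    by (rule holomorphic_on_imp_continuous_on)
  moreover have "residual_kernel t k us holomorphic_on ball 0 1"
    using hol by (rule holomorphic_on_subset) auto
  ultimately have "(LINT y|circle_measure. residual_kernel t k us y) = residual_kernel t k us 0"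
    by (intro integral_circle_holomorphic borel_measurable_residual_kernel)
  also have "\<dots> = (if k = 0 then t ^ length us else 0)"
    by (simp add: residual_kernel_def power_0_left map_replicate_const)
  finally show ?thesis .
qed

lemma borel_measurable_density_on:
  assumes "finite J"
  shows "density_on t J \<in> borel_measurable (circles J)"
proof -
  have inv: "(\<lambda>x. inverse (f x)) \<in> borel_measurable (circles J)"
    if "f \<in> borel_measurable (circles J)" for f :: "_ \<Rightarrow> complex"
    using that by measurable
  show ?thesis
    unfolding density_on_def diag_factor_def cross_factor_def
    by (intro borel_measurable_prod borel_measurable_divide borel_measurable_diff borel_measurable_times
        borel_measurable_power inv borel_measurable_const measurable_coordinate) auto
qed

definition word_integrand ::
  "complex \<Rightarrow> nat set \<Rightarrow> nat list \<Rightarrow> nat list \<Rightarrow> (nat \<Rightarrow> complex) \<Rightarrow> complex" where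
  "word_integrand t J ls ws x = hl_word t (inverse_pairs x) ls ws * density_on t J x"

lemma monomial_word_Cons: "monomial_word z (l # ls) (a # ws) = z a ^ l * monomial_word z ls ws"
  by (simp add: monomial_word_def)

lemma monomial_word_insert:
  assumes "length LA = length A"
  shows "monomial_word z (LA @ l # LB) (A @ a # B) = z a ^ l * monomial_word z (LA @ LB) (A @ B)"
  using assms by (simp add: monomial_word_def mult_ac)

lemma borel_measurable_word_integrand:
  assumes J: "finite J" and ws: "set ws \<subseteq> letters J"
  shows "word_integrand t J ls ws \<in> borel_measurable (circles J)"
proof -
  have coord [measurable]: "(\<lambda>x. inverse_pairs x (ws ! i)) \<in> borel_measurable (circles J)" if "i < length ws" for i
    using that ws by (intro measurable_inverse_pairs) (auto simp: subset_iff)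
  have mono: "(\<lambda>x. monomial_word (inverse_pairs x) ls vs) \<in> borel_measurable (circles J)"
    if "set vs \<subseteq> letters J" for vs
    using that
  proof (induction ls vs rule: list_induct2')
    case (4 l ls a vs)
    then show ?case
      unfolding monomial_word_Cons
      by (intro borel_measurable_times borel_measurable_power measurable_inverse_pairs) auto
  qed (simp_all add: monomial_word_def)
  have pair: "(\<lambda>x. pair_prod (\<lambda>a b. (inverse_pairs x a - t * inverse_pairs x b) /
      (inverse_pairs x a - inverse_pairs x b)) ws) \<in> borel_measurable (circles J)"
    unfolding pair_prod_conv_nth
    by (intro borel_measurable_prod borel_measurable_divide borel_measurable_diff borel_measurable_times
        borel_measurable_const coord) auto
  show ?thesis
    unfolding word_integrand_def hl_word_def
    by (intro borel_measurable_times mono[OF ws] pair borel_measurable_density_on[OF J])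
qed

lemma prod_list_map_mult:
  fixes f g :: "'a \<Rightarrow> complex"
  shows "(\<Prod>b\<leftarrow>bs. f b) * (\<Prod>b\<leftarrow>bs. g b) = (\<Prod>b\<leftarrow>bs. f b * g b)"
  by (induction bs) (simp_all add: mult_ac)

text \<open>The cancellation on which the proof rests.  Every letter other than the first one and its partner
is either between them or after them, and its factors are those of \<open>factor_before_partner\<close> or
\<open>factor_after_partner\<close>.\<close>
lemma word_integrand_split:
  assumes t: "norm t < 1" and J: "finite J" "a div 2 \<notin> J"
    and x: "generic (insert (a div 2) J) x"
    and AB: "A @ B \<in> permutations_of_set (letters J)"
    and L: "length LA = length A" "l' \<le> l"
  shows "word_integrand t (insert (a div 2) J) (l # LA @ l' # LB) (a # A @ partner a # B) x =
    residual_kernel t (l - l') (map (inverse_pairs x) A) (inverse_pairs x a) *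
    word_integrand t J (LA @ LB) (A @ B) x"
proof -
  define z where "z = inverse_pairs x"
  define y where "y = z a"
  define f where "f u v = (u - t * v) / (u - v)" for u v
  have zp: "z (partner a) = inverse y"
    by (simp add: z_def y_def inverse_pairs_partner)
  let ?S = "letters (insert (a div 2) J)"
  have in_S: "a \<in> ?S" "partner a \<in> ?S"
    by (simp_all add: letters_insert)
  have inj: "inj_on z ?S" and norm_z: "\<And>k. k \<in> ?S \<Longrightarrow> norm (z k) = 1"
    using x norm_inverse_pairs[OF x] by (simp_all add: generic_def z_def)
  have y: "norm y = 1" "y \<noteq> 0"
    using norm_z[OF in_S(1)] by (auto simp: y_def)
  have "z a \<noteq> z (partner a)"
    using inj in_S partner_neq[of a] by (metis inj_on_eq_iff)
  then have y_inv: "y \<noteq> inverse y"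
    using zp by (metis y_def)
  have set_AB: "set (A @ B) = letters J" and dist: "distinct (A @ B)"
    using AB by (auto simp: permutations_of_set_def)
  have zb: "norm (z b) = 1" "y \<noteq> z b" "z b \<noteq> inverse y" if "b \<in> set (A @ B)" for b
  proof -
    have b: "b \<in> ?S" "b \<noteq> a" "b \<noteq> partner a"
      using that J unfolding set_AB by (auto simp: letters_def)
    then have "norm (z b) = 1" "z a \<noteq> z b" "z b \<noteq> z (partner a)"
      using norm_z inj in_S by (auto simp: inj_on_eq_iff)
    then show "norm (z b) = 1" "y \<noteq> z b" "z b \<noteq> inverse y"
      unfolding zp y_def by simp_all
  qed
  have A: "(\<Prod>b\<leftarrow>A. f y (z b)) * (\<Prod>b\<leftarrow>A. f (z b) (inverse y)) * (\<Prod>b\<leftarrow>A. cross_factor t y (z b)) =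
      (\<Prod>b\<leftarrow>A. (t - y * z b) / (1 - t * y * z b))"
    unfolding prod_list_map_mult f_def
    by (intro arg_cong[where f = prod_list] map_cong refl factor_before_partner[OF t y(1)]) (use zb in auto)
  have "(\<Prod>b\<leftarrow>B. f y (z b)) * (\<Prod>b\<leftarrow>B. f (inverse y) (z b)) * (\<Prod>b\<leftarrow>B. cross_factor t y (z b)) =
      (\<Prod>b\<leftarrow>B. 1)"
    unfolding prod_list_map_mult f_def
    by (intro arg_cong[where f = prod_list] map_cong refl factor_after_partner[OF t y(1)]) (use zb in auto)
  then have B: "(\<Prod>b\<leftarrow>B. f y (z b)) * (\<Prod>b\<leftarrow>B. f (inverse y) (z b)) * (\<Prod>b\<leftarrow>B. cross_factor t y (z b)) = 1"
    by (simp add: map_replicate_const)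
  have C: "f y (inverse y) * diag_factor t y = (1 - y\<^sup>2) / (1 - t * y\<^sup>2)"
    unfolding f_def by (rule factor_partner[OF t y(1) y_inv])
  have D: "y ^ l * inverse y ^ l' = y ^ (l - l')"
    using L(2) y(2) by (simp add: power_inverse power_diff divide_inverse)
  have mono: "monomial_word z (l # LA @ l' # LB) (a # A @ partner a # B) =
      y ^ l * inverse y ^ l' * monomial_word z (LA @ LB) (A @ B)"
    using L by (simp add: monomial_word_Cons monomial_word_insert zp y_def mult.assoc)
  have pair: "pair_prod (\<lambda>b c. f (z b) (z c)) (a # A @ partner a # B) =
      ((\<Prod>b\<leftarrow>A. f y (z b)) * f y (inverse y) * (\<Prod>b\<leftarrow>B. f y (z b))) *
      ((\<Prod>b\<leftarrow>A. f (z b) (inverse y)) * (\<Prod>b\<leftarrow>B. f (inverse y) (z b))) * pair_prod (\<lambda>b c. f (z b) (z c)) (A @ B)"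
    by (simp add: pair_prod_insert zp mult_ac flip: y_def)
  have "(\<Prod>b\<in>letters J. cross_factor t y (z b)) = (\<Prod>b\<leftarrow>A @ B. cross_factor t y (z b))"
    unfolding set_AB[symmetric] using dist by (rule prod.distinct_set_conv_list)
  then have dens: "density_on t (insert (a div 2) J) x =
      diag_factor t y * ((\<Prod>b\<leftarrow>A. cross_factor t y (z b)) * (\<Prod>b\<leftarrow>B. cross_factor t y (z b))) * density_on t J x"
    unfolding density_on_insert[OF J] by (simp add: z_def y_def)
  have "word_integrand t (insert (a div 2) J) (l # LA @ l' # LB) (a # A @ partner a # B) x =
      (y ^ l * inverse y ^ l') * (f y (inverse y) * diag_factor t y) *
      ((\<Prod>b\<leftarrow>A. f y (z b)) * (\<Prod>b\<leftarrow>A. f (z b) (inverse y)) * (\<Prod>b\<leftarrow>A. cross_factor t y (z b))) *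
      ((\<Prod>b\<leftarrow>B. f y (z b)) * (\<Prod>b\<leftarrow>B. f (inverse y) (z b)) * (\<Prod>b\<leftarrow>B. cross_factor t y (z b))) *
      (monomial_word z (LA @ LB) (A @ B) * pair_prod (\<lambda>b c. f (z b) (z c)) (A @ B) * density_on t J x)"
    unfolding word_integrand_def hl_word_def z_def[symmetric] f_def[symmetric] mono pair dens
    by (simp only: mult_ac)
  then show ?thesis
    unfolding A B C D
    by (simp add: residual_kernel_def word_integrand_def hl_word_def f_def comp_def flip: z_def y_def)
qed

lemma residual_kernel_bound:
  assumes t: "norm t < 1" and y: "norm y = 1" and us: "\<And>u. u \<in> set us \<Longrightarrow> norm u = 1"
  shows "norm (residual_kernel t k us y) \<le> (2 / (1 - norm t)) ^ Suc (length us)"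
proof -
  have quot: "norm ((p - q) / (1 - t * r)) \<le> 2 / (1 - norm t)"
    if "norm p \<le> 1" "norm q \<le> 1" "norm r = 1" for p q r
  proof -
    have "norm (p - q) \<le> 2" using norm_triangle_ineq4[of p q] that by simp
    moreover have "1 - norm t \<le> norm (1 - t * r)"
      using norm_triangle_ineq2[of 1 "t * r"] that by (simp add: norm_mult)
    ultimately show ?thesis
      unfolding norm_divide using t by (intro frac_le) auto
  qed
  have "norm (\<Prod>u\<leftarrow>us. (t - y * u) / (1 - t * y * u)) \<le> (2 / (1 - norm t)) ^ length us"
    using us
  proof (induction us)
    case (Cons u us)
    have "norm ((t - y * u) / (1 - t * (y * u))) \<le> 2 / (1 - norm t)"
      using Cons.prems[of u] y t by (intro quot) (auto simp: norm_mult)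
    then show ?case
      using Cons t by (simp add: norm_mult mult.assoc mult_mono del: times_divide_eq_left times_divide_eq_right)
  qed simp
  moreover have "norm ((1 - y\<^sup>2) / (1 - t * y\<^sup>2)) \<le> 2 / (1 - norm t)"
    using y by (intro quot) (auto simp: norm_power)
  ultimately show ?thesis
    unfolding residual_kernel_def norm_mult norm_power y using t
    by (simp add: mult_mono del: times_divide_eq_left times_divide_eq_right)
qed

lemma generic_subset: "generic J x \<Longrightarrow> I \<subseteq> J \<Longrightarrow> generic I x"
  unfolding generic_def by (auto intro: inj_on_subset simp: letters_def subset_iff)

lemma word_decomposition:
  assumes J: "finite J" "a div 2 \<notin> J"
    and AB: "a # ws \<in> permutations_of_set (letters (insert (a div 2) J))"
  obtains A B where "ws = A @ partner a # B" "A @ B \<in> permutations_of_set (letters J)"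
proof -
  have ws: "set (a # ws) = insert a (insert (partner a) (letters J))" "distinct (a # ws)"
    using AB by (auto simp: permutations_of_set_def letters_insert)
  have neq: "partner a \<noteq> a" by simp
  have "partner a \<in> set (a # ws)" unfolding ws(1) by simp
  then have "partner a \<in> set ws" using neq by simp
  then obtain A B where AB: "ws = A @ partner a # B" by (meson split_list)
  have "a \<notin> letters J" "partner a \<notin> letters J"
    using J by (auto simp: letters_def)
  then have "set (A @ B) = letters J" "distinct (A @ B)"
    using ws AB neq by auto
  then show ?thesis
    using AB by (intro that[of A B]) (auto simp: permutations_of_set_def)
qed

text \<open>The residual kernel is bounded on the circle, so a bound for the word without its first pair yields
one for the whole word.  This makes the individual words integrable, although single quotients
of the symmetrization formula have poles on the torus.\<close>
lemma word_integrand_bounded: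
  assumes "norm t < 1" "finite J" "length ls = 2 * card J" "sorted_wrt (\<ge>) ls"
    and "ws \<in> permutations_of_set (letters J)"
  shows "\<exists>C. \<forall>x. generic J x \<longrightarrow> norm (word_integrand t J ls ws x) \<le> C"
  using assms(2-)
proof (induction "card J" arbitrary: J ls ws)
  case 0
  then have "J = {}" "ls = []" "ws = []" by auto
  then show ?case
    by (auto simp: word_integrand_def hl_word_def monomial_word_def density_on_def)
next
  case (Suc m)
  have "length ws = 2 * Suc m"
    using Suc by (simp add: length_finite_permutations_of_set card_letters)
  then obtain a ws' where ws: "ws = a # ws'" by (cases ws) auto
  define J' where "J' = J - {a div 2}"
  have a: "a div 2 \<in> J"
    using Suc.prems(4) unfolding ws by (auto simp: permutations_of_set_def letters_def)
  have J: "J = insert (a div 2) J'" and J': "finite J'" "a div 2 \<notin> J'" "m = card J'"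
    using a Suc.prems(1) Suc.hyps(2) by (auto simp: J'_def)
  obtain A B where AB: "ws' = A @ partner a # B" "A @ B \<in> permutations_of_set (letters J')"
    using word_decomposition[OF J'(1,2)] Suc.prems(4) unfolding ws J by blast
  have lenAB: "length (A @ B) = 2 * m"
    using AB J' by (simp only: length_finite_permutations_of_set card_letters)
  obtain l ls' where ls: "ls = l # ls'" using Suc by (cases ls) auto
  have "length A < length ls'"
    using Suc.prems(2) Suc.hyps(2) lenAB ls by simp
  then have ls': "ls' = take (length A) ls' @ ls' ! length A # drop (Suc (length A)) ls'"
    by (rule id_take_nth_drop)
  define LA where "LA = take (length A) ls'"
  define LB where "LB = drop (Suc (length A)) ls'"
  define l' where "l' = ls' ! length A"
  have ls_eq: "ls = l # LA @ l' # LB" and lenA: "length LA = length A"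
    using ls ls' \<open>length A < length ls'\<close> by (simp_all add: LA_def LB_def l'_def)
  have "\<exists>C. \<forall>x. generic J' x \<longrightarrow> norm (word_integrand t J' (LA @ LB) (A @ B) x) \<le> C"
    using Suc.prems(2,3) Suc.hyps(2) J' AB(2) unfolding ls_eq
    by (intro Suc.hyps(1)) (auto simp: sorted_wrt_append)
  then obtain C where C: "\<And>x. generic J' x \<Longrightarrow> norm (word_integrand t J' (LA @ LB) (A @ B) x) \<le> C"
    by blast
  have l': "l' \<le> l" using Suc.prems(3) unfolding ls_eq by simp
  let ?K = "(2 / (1 - norm t)) ^ Suc (length A)"
  have "norm (word_integrand t J ls ws x) \<le> ?K * C" if x: "generic J x" for x
  proof -
    have "norm (residual_kernel t (l - l') (map (inverse_pairs x) A) (inverse_pairs x a)) \<le>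
        (2 / (1 - norm t)) ^ Suc (length (map (inverse_pairs x) A))"
      using AB(2) a
      by (intro residual_kernel_bound[OF assms(1)])
        (auto intro!: norm_inverse_pairs[OF x] simp: J permutations_of_set_def letters_insert)
    moreover have "norm (word_integrand t J' (LA @ LB) (A @ B) x) \<le> C"
      using x by (intro C generic_subset[OF x]) (auto simp: J)
    moreover have "0 \<le> ?K" using assms(1) by simp
    ultimately show ?thesis
      unfolding ls_eq ws AB(1) J
      using word_integrand_split[OF assms(1) J'(1,2) x[unfolded J] AB(2) lenA l', of LB]
      by (simp only: norm_mult length_map mult_mono norm_ge_zero)
  qed
  then show ?case by blast
qed

lemma integrable_generic_bounded:
  fixes f :: "(nat \<Rightarrow> complex) \<Rightarrow> complex"
  assumes "finite J" "f \<in> borel_measurable (circles J)" "\<And>x. generic J x \<Longrightarrow> norm (f x) \<le> C"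
  shows "integrable (circles J) f"
proof -
  interpret prob_space "circles J" by (rule prob_space_circles)
  show ?thesis
    using AE_generic[OF assms(1)] assms(2,3)
    by (intro integrable_const_bound[where B = C]) (auto elim!: eventually_mono)
qed

lemma integrable_word_integrand:
  assumes "norm t < 1" "finite J" "length ls = 2 * card J" "sorted_wrt (\<ge>) ls"
    and "ws \<in> permutations_of_set (letters J)"
  shows "integrable (circles J) (word_integrand t J ls ws)"
proof -
  obtain C where "\<And>x. generic J x \<Longrightarrow> norm (word_integrand t J ls ws x) \<le> C"
    using word_integrand_bounded[OF assms] by blast
  moreover have "set ws \<subseteq> letters J"
    using assms(5) by (simp add: permutations_of_set_def)
  ultimately show ?thesis
    using assms(2) by (intro integrable_generic_bounded borel_measurable_word_integrand)
qed

lemma word_integrand_upd: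
  assumes "i \<notin> J" "set ws \<subseteq> letters J"
  shows "word_integrand t J ls ws (x(i := y)) = word_integrand t J ls ws x"
proof -
  have z: "inverse_pairs (x(i := y)) k = inverse_pairs x k" if "k \<in> letters J" for k
    using that assms(1) by (intro inverse_pairs_upd) (auto simp: letters_def)
  have "monomial_word (inverse_pairs (x(i := y))) ls vs = monomial_word (inverse_pairs x) ls vs"
    if "set vs \<subseteq> letters J" for vs
    using that
    by (induction ls vs rule: list_induct2') (auto simp: monomial_word_Cons z, auto simp: monomial_word_def)
  moreover have pair: "pair_prod (\<lambda>a b. f (inverse_pairs (x(i := y)) a) (inverse_pairs (x(i := y)) b)) vs =
      pair_prod (\<lambda>a b. f (inverse_pairs x a) (inverse_pairs x b)) vs"
    if "set vs \<subseteq> letters J" for vs and f :: "complex \<Rightarrow> complex \<Rightarrow> complex"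
    using that by (induction vs) (auto simp: z subset_iff cong: map_cong)
  moreover have "density_on t J (x(i := y)) = density_on t J x"
    unfolding density_on_def using assms(1)
    by (intro arg_cong2[where f = "(*)"] prod.cong) auto
  ultimately show ?thesis
    using assms(2) pair[where f = "\<lambda>u v. (u - t * v) / (u - v)"]
    by (simp add: word_integrand_def hl_word_def)
qed

text \<open>By Fubini the variable of the first letter can be integrated first.  The word that remains does not
involve it, so the inner integral is that of the residual kernel.\<close>
lemma integral_word_integrand:
  assumes t: "norm t < 1" and J: "finite J" "a div 2 \<notin> J"
    and AB: "A @ B \<in> permutations_of_set (letters J)"
    and L: "length LA = length A" "length LB = length B" "sorted_wrt (\<ge>) (l # LA @ l' # LB)"
  shows "(LINT x|circles (insert (a div 2) J).
      word_integrand t (insert (a div 2) J) (l # LA @ l' # LB) (a # A @ partner a # B) x) =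
    (if l = l' then t ^ length A else 0) * (LINT x|circles J. word_integrand t J (LA @ LB) (A @ B) x)"
proof -
  let ?i = "a div 2"
  let ?W = "word_integrand t (insert ?i J) (l # LA @ l' # LB) (a # A @ partner a # B)"
  let ?V = "word_integrand t J (LA @ LB) (A @ B)"
  let ?c = "if l = l' then t ^ length A else 0"
  have set_AB: "set (A @ B) = letters J" and "distinct (A @ B)"
    using AB by (auto simp: permutations_of_set_def)
  have l': "l' \<le> l" using L(3) by simp
  have "a \<notin> set (A @ B)" "partner a \<notin> set (A @ B)"
    unfolding set_AB using J by (simp_all add: letters_def)
  moreover have "a \<noteq> partner a" by (metis partner_neq)
  moreover have "set (a # A @ partner a # B) = letters (insert ?i J)"
    unfolding letters_insert set_AB[symmetric] by auto
  ultimately have "a # A @ partner a # B \<in> permutations_of_set (letters (insert ?i J))"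
    using \<open>distinct (A @ B)\<close> by (simp add: permutations_of_set_def)
  moreover have "length (l # LA @ l' # LB) = 2 * card (insert ?i J)"
    using length_finite_permutations_of_set[OF AB] J L by (simp add: card_letters)
  ultimately have int: "integrable (circles (insert ?i J)) ?W"
    using t J L(3) by (intro integrable_word_integrand) auto
  have "(LINT x|circles (insert ?i J). ?W x) = (LINT x|circles J. LINT y|circle_measure. ?W (x(?i := y)))"
    by (rule circle.product_integral_insert[OF J int])
  also have "\<dots> = (LINT x|circles J. ?c * ?V x)"
  proof (rule integral_cong_AE)
    show "(\<lambda>x. LINT y|circle_measure. ?W (x(?i := y))) \<in> borel_measurable (circles J)"
    proof -
      interpret sigma_finite_measure circle_measure
        using prob_space_circle prob_space_imp_sigma_finite by blast
      have [measurable]: "?W \<in> borel_measurable (circles (insert ?i J))"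
        by (rule borel_measurable_integrable[OF int])
      show ?thesis by measurable
    qed
    show "(\<lambda>x. ?c * ?V x) \<in> borel_measurable (circles J)"
      using set_AB J by (intro borel_measurable_times borel_measurable_const borel_measurable_word_integrand) auto
    show "AE x in circles J. (LINT y|circle_measure. ?W (x(?i := y))) = ?c * ?V x"
      using AE_generic[OF J(1)] AE_space
    proof eventually_elim
      case (elim x)
      let ?us = "map (inverse_pairs x) A"
      \<comment> \<open>If \<open>a\<close> is odd, the first letter of the word is the inverse of the integration variable.\<close>
      let ?e = "\<lambda>y. if even a then y else inverse y"
      have us: "norm u = 1" if "u \<in> set ?us" for u
        using that norm_inverse_pairs[OF elim(1)] set_AB by auto
      have fin: "finite ({1, - 1} \<union> inverse_pairs x ` letters J)" using J by simp
      have eq: "AE y in circle_measure. ?W (x(?i := y)) = residual_kernel t (l - l') ?us (?e y) * ?V x"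
        using AE_circle_norm AE_circle_notin_finite[OF fin]
      proof eventually_elim
        case (elim y)
        have gen: "generic (insert ?i J) (x(?i := y))"
          by (rule generic_insert[OF \<open>generic J x\<close> J(2) elim])
        have "map (inverse_pairs (x(?i := y))) A = ?us"
          using set_AB J(2) by (intro map_cong refl inverse_pairs_upd) (metis UnI1 letters_def mem_Collect_eq set_append)
        moreover have "inverse_pairs (x(?i := y)) a = ?e y"
          by (simp add: inverse_pairs_def)
        moreover have "?V (x(?i := y)) = ?V x"
          using J(2) set_AB by (intro word_integrand_upd) auto
        ultimately show ?case
          using word_integrand_split[OF t J gen AB L(1) l', of LB] by (simp only:)
      qed
      have meas_upd: "(\<lambda>y. x(?i := y)) \<in> measurable circle_measure (circles (insert ?i J))"
        using \<open>x \<in> space (circles J)\<close> by (intro measurable_fun_upd[where J = J]) auto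
      have meas_e: "(\<lambda>y. residual_kernel t (l - l') ?us (?e y)) \<in> borel_measurable borel"
        by (rule measurable_compose[OF _ borel_measurable_residual_kernel]) measurable
      have "(LINT y|circle_measure. ?W (x(?i := y))) =
          (LINT y|circle_measure. residual_kernel t (l - l') ?us (?e y) * ?V x)"
      proof (rule integral_cong_AE[OF _ _ eq])
        show "(\<lambda>y. ?W (x(?i := y))) \<in> borel_measurable circle_measure"
          by (rule measurable_compose[OF meas_upd borel_measurable_integrable[OF int]])
        show "(\<lambda>y. residual_kernel t (l - l') ?us (?e y) * ?V x) \<in> borel_measurable circle_measure"
          using meas_e by (intro borel_measurable_times borel_measurable_const)
            (simp cong: measurable_cong_sets)
      qed
      also have "\<dots> = (LINT y|circle_measure. residual_kernel t (l - l') ?us (?e y)) * ?V x"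
        by simp
      also have "(LINT y|circle_measure. residual_kernel t (l - l') ?us (?e y)) =
          (LINT y|circle_measure. residual_kernel t (l - l') ?us y)"
        using integral_circle_inverse[OF borel_measurable_residual_kernel] by (cases "even a") simp_all
      also have "\<dots> = ?c"
        using residual_kernel_integral[OF t us, of ?us "l - l'"] l' by simp
      finally show ?case .
    qed
  qed
  also have "\<dots> = ?c * (LINT x|circles J. ?V x)"
    by simp
  finally show ?thesis .
qed

section \<open>Summing over all words\<close>

text \<open>A word is determined by its first letter, the position of the partner of that letter and the word
formed by the other letters.  The inner sums do not depend on the first letter, so each of the
\<open>2 * card J\<close> choices contributes equally; this produces the order \<open>2^m m!\<close> of the hyperoctahedral
group, which is the normalizing constant of the density.\<close>
lemma sum_integral_words:
  assumes "norm t < 1" "finite J" "length ls = 2 * card J" "sorted_wrt (\<ge>) ls"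
  shows "(\<Sum>ws\<in>permutations_of_set (letters J). LINT x|circles J. word_integrand t J ls ws x) =
    2 ^ card J * fact (card J) * multiset_matching_poly t ls"
  using assms(2-)
proof (induction "card J" arbitrary: J ls)
  case 0
  then have "J = {}" "ls = []" by auto
  interpret prob_space "circles {}" by (rule prob_space_circles)
  from \<open>J = {}\<close> \<open>ls = []\<close> show ?case
    by (simp add: word_integrand_def hl_word_def monomial_word_def density_on_def
        multiset_matching_poly_def prob_space)
next
  case (Suc m)
  obtain l ls' where ls: "ls = l # ls'" using Suc by (cases ls) auto
  have len: "length ls' = 2 * m + 1" using Suc ls by simp
  let ?S = "letters J"
  have "?S \<noteq> {}" "card ?S = 2 * Suc m" "finite ?S"
    using Suc card_letters[of J] by auto
  define rest where "rest p = take p ls' @ drop (Suc p) ls'" for p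
  define R where "R = 2 ^ m * fact m *
    (\<Sum>p<length ls'. if ls' ! p = l then t ^ p * multiset_matching_poly t (rest p) else 0)"
  have first: "(\<Sum>us\<in>permutations_of_set (?S - {a}). LINT x|circles J. word_integrand t J ls (a # us) x) = R"
    if a: "a \<in> ?S" for a
  proof -
    define J' where "J' = J - {a div 2}"
    have J: "J = insert (a div 2) J'" and J': "finite J'" "a div 2 \<notin> J'" "m = card J'"
      using a Suc.prems(1) Suc.hyps(2) by (auto simp: J'_def letters_def)
    have notin: "a \<notin> letters J'" "partner a \<notin> letters J'" "partner a \<noteq> a"
      using J' by (simp_all add: letters_def)
    have S: "?S - {a} = insert (partner a) (letters J')"
      unfolding J letters_insert using notin by auto
    have "(\<Sum>us\<in>permutations_of_set (?S - {a}). LINT x|circles J. word_integrand t J ls (a # us) x) =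
        (\<Sum>p\<le>2 * m. \<Sum>us\<in>permutations_of_set (letters J').
          LINT x|circles J. word_integrand t J ls (a # take p us @ partner a # drop p us) x)"
      unfolding S using J' notin
      by (subst sum_permutations_of_set_insert) (simp_all add: card_letters)
    also have "\<dots> = (\<Sum>p\<le>2 * m. if ls' ! p = l then t ^ p * (2 ^ m * fact m * multiset_matching_poly t (rest p)) else 0)"
    proof (rule sum.cong[OF refl])
      fix p assume "p \<in> {..2 * m}"
      then have p: "p < length ls'" using len by simp
      have ls_eq: "ls = l # take p ls' @ ls' ! p # drop (Suc p) ls'"
        unfolding ls using id_take_nth_drop[OF p] by simp
      have sorted: "sorted_wrt (\<ge>) (l # take p ls' @ ls' ! p # drop (Suc p) ls')"
        using Suc.prems(3) unfolding ls_eq[symmetric] .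
      have "(LINT x|circles J. word_integrand t J ls (a # take p us @ partner a # drop p us) x) =
          (if l = ls' ! p then t ^ p else 0) * (LINT x|circles J'. word_integrand t J' (rest p) us x)"
        if us: "us \<in> permutations_of_set (letters J')" for us
      proof -
        have "length us = 2 * m"
          using us J' by (simp only: length_finite_permutations_of_set card_letters)
        then have lens: "length (take p ls') = length (take p us)"
          "length (drop (Suc p) ls') = length (drop p us)" "length (take p us) = p"
          using p len by auto
        show ?thesis
          using integral_word_integrand[OF assms(1) J'(1,2) _ lens(1,2) sorted] us
          unfolding ls_eq[symmetric] J[symmetric] rest_def lens(3) by simp
      qed
      then have "(\<Sum>us\<in>permutations_of_set (letters J').
          LINT x|circles J. word_integrand t J ls (a # take p us @ partner a # drop p us) x) =
          (if l = ls' ! p then t ^ p else 0) *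
          (\<Sum>us\<in>permutations_of_set (letters J'). LINT x|circles J'. word_integrand t J' (rest p) us x)"
        by (simp add: sum_distrib_left)
      also have "(\<Sum>us\<in>permutations_of_set (letters J'). LINT x|circles J'. word_integrand t J' (rest p) us x) =
          2 ^ m * fact m * multiset_matching_poly t (rest p)"
      proof -
        have "length (rest p) = 2 * card J'" "sorted_wrt (\<ge>) (rest p)"
          using p len J' sorted by (auto simp: rest_def sorted_wrt_append)
        then show ?thesis using Suc.hyps(1)[OF J'(3,1)] J'(3) by simp
      qed
      finally show "(\<Sum>us\<in>permutations_of_set (letters J').
          LINT x|circles J. word_integrand t J ls (a # take p us @ partner a # drop p us) x) =
          (if ls' ! p = l then t ^ p * (2 ^ m * fact m * multiset_matching_poly t (rest p)) else 0)"
        by auto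
    qed
    also have "\<dots> = R"
    proof -
      have "{..2 * m} = {..<length ls'}" using len by auto
      then show ?thesis
        unfolding R_def sum_distrib_left by (intro sum.cong) auto
    qed
    finally show ?thesis .
  qed
  have "(\<Sum>ws\<in>permutations_of_set ?S. LINT x|circles J. word_integrand t J ls ws x) = of_nat (card ?S) * R"
    unfolding sum_permutations_of_set_Cons[OF \<open>finite ?S\<close> \<open>?S \<noteq> {}\<close>] by (simp add: first)
  also have "\<dots> = 2 ^ Suc m * fact (Suc m) * multiset_matching_poly t ls"
    unfolding \<open>card ?S = 2 * Suc m\<close> R_def ls rest_def
      multiset_matching_poly_Cons[OF Suc.prems(3)[unfolded ls]]
    by simp
  finally show ?case using Suc.hyps(2) by simp
qed

lemma hall_littlewood_conv_words:
  "hall_littlewood N lam t z =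
    1 / hl_v N lam t * (\<Sum>ws\<in>permutations_of_set {..<N}. hl_word t z (map lam [0..<N]) ws)"
proof -
  have "monomial_word z (map lam [0..<N]) (map w [0..<N]) = (\<Prod>i<N. z (w i) ^ lam i)" for w
  proof -
    have "zip (map lam [0..<N]) (map w [0..<N]) = map (\<lambda>i. (lam i, w i)) [0..<N]"
      by (induction N) auto
    then show ?thesis
      by (simp add: monomial_word_def comp_def atLeast0LessThan flip: prod.distinct_set_conv_list)
  qed
  moreover have "pair_prod f (map w [0..<N]) = (\<Prod>j<N. \<Prod>i<j. f (w i) (w j))"
    for f :: "nat \<Rightarrow> nat \<Rightarrow> complex" and w
    unfolding pair_prod_conv_nth by (intro prod.cong) auto
  ultimately show ?thesis
    unfolding hall_littlewood_def sum_permutes_conv_permutations_of_set[symmetric] hl_word_def by simp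
qed

lemma sorted_parts: "antimono lam \<Longrightarrow> sorted_wrt (\<ge>) (map lam [0..<N])"
  by (auto simp: sorted_wrt_map antimono_def intro!: sorted_wrt_mono_rel[OF _ sorted_wrt_upt])

lemma torus_measure_eq: "torus_measure n = circles {..<n}"
  by (simp add: torus_measure_def)

lemma hall_littlewood_density_conv_words:
  assumes "sqrt_t ^ 2 = t"
  shows "hall_littlewood (2 * n) lam t (inverse_pairs x) * koornwinder_density n sqrt_t (- sqrt_t) 0 0 t x =
    1 / (hl_v (2 * n) lam t * (2 ^ n * fact n)) *
    (\<Sum>ws\<in>permutations_of_set (letters {..<n}). word_integrand t {..<n} (map lam [0..<2 * n]) ws x)"
  unfolding hall_littlewood_conv_words koornwinder_density_eq[OF assms] letters_lessThan word_integrand_def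
  by (simp add: sum_distrib_right)

lemma
  assumes t: "norm t < 1" "sqrt_t ^ 2 = t" and lam: "antimono lam"
  shows integrable_hall_littlewood_density:
      "integrable (torus_measure n) (\<lambda>x. hall_littlewood (2 * n) lam t (inverse_pairs x) *
        koornwinder_density n sqrt_t (- sqrt_t) 0 0 t x)" (is ?int)
    and integral_hall_littlewood_density:
      "(LINT x|torus_measure n. hall_littlewood (2 * n) lam t (inverse_pairs x) *
        koornwinder_density n sqrt_t (- sqrt_t) 0 0 t x) =
      multiset_matching_poly t (map lam [0..<2 * n]) / hl_v (2 * n) lam t" (is ?eq)
proof -
  let ?ls = "map lam [0..<2 * n]"
  let ?P = "permutations_of_set (letters {..<n})"
  have int: "integrable (circles {..<n}) (word_integrand t {..<n} ?ls ws)" if "ws \<in> ?P" for ws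
    using t that sorted_parts[OF lam] by (intro integrable_word_integrand) auto
  then show ?int
    unfolding torus_measure_eq hall_littlewood_density_conv_words[OF t(2)] by auto
  have "(LINT x|circles {..<n}. (\<Sum>ws\<in>?P. word_integrand t {..<n} ?ls ws x)) =
      (\<Sum>ws\<in>?P. (LINT x|circles {..<n}. word_integrand t {..<n} ?ls ws x))"
    using int by (rule Bochner_Integration.integral_sum)
  also have "\<dots> = 2 ^ n * fact n * multiset_matching_poly t ?ls"
    using sum_integral_words[OF t(1), of "{..<n}" ?ls] sorted_parts[OF lam] by simp
  finally show ?eq
    unfolding torus_measure_eq hall_littlewood_density_conv_words[OF t(2)] by simp
qed

lemma one_minus_power_neq_0:
  fixes t :: complex
  assumes "norm t < 1" "j > 0"
  shows "1 - t ^ j \<noteq> 0"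
  using one_minus_neq_0[OF assms(1), of "t ^ (j - 1)"] assms
  by (cases j) (simp_all add: norm_power power_le_one)

text \<open>This holds only almost everywhere, since the symmetrization formula divides by 0 at points where
two letters coincide.\<close>
lemma AE_hall_littlewood_zero:
  assumes t: "norm t < 1" and n: "n \<ge> 1"
  shows "AE x in torus_measure n. hall_littlewood (2 * n) (\<lambda>_. 0) t (inverse_pairs x) = 1"
  unfolding torus_measure_eq
  using AE_generic[of "{..<n}", OF finite_lessThan]
proof eventually_elim
  case (elim x)
  let ?z = "inverse_pairs x" and ?b = "\<Prod>j=1..2 * n. (1 - t ^ j) / (1 - t)"
  have "t \<noteq> 1" using t by auto
  have "(\<Sum>ws\<in>permutations_of_set {..<2 * n}. pair_prod (\<lambda>a b. (?z a - t * ?z b) / (?z a - ?z b)) ws) =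
      (\<Prod>j=1..card {..<2 * n}. (1 - t ^ j) / (1 - t))"
    using elim norm_inverse_pairs[OF elim] unfolding generic_def letters_lessThan
    by (intro sum_permutations_t_quotients \<open>t \<noteq> 1\<close>) fastforce+
  moreover have "(\<lambda>_. 0 :: nat) ` {..<2 * n} = {0}"
    using n by (subst image_constant[of 0]) auto
  then have "hl_v (2 * n) (\<lambda>_. 0) t = ?b"
    by (simp add: hl_v_def part_mult_def)
  moreover have "?b \<noteq> 0"
    using one_minus_power_neq_0[OF t] \<open>t \<noteq> 1\<close> by auto
  moreover have "monomial_word ?z (map (\<lambda>_. 0) xs) ws = 1" for xs :: "nat list" and ws
    by (induction xs ws rule: list_induct2') (simp_all add: monomial_word_def)
  ultimately show ?case
    by (simp add: hall_littlewood_conv_words hl_word_def)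
qed

section \<open>Multiplicities and the final evaluation\<close>

lemma num_parts_support:
  assumes "int_partition lam"
  shows "lam i \<noteq> 0 \<longleftrightarrow> i < num_parts lam"
proof -
  let ?S = "{i. lam i \<noteq> 0}"
  have anti: "antimono lam" and fin: "finite ?S"
    using assms by (auto simp: int_partition_def)
  have down: "j \<in> ?S" if "i \<in> ?S" "j \<le> i" for i j
    using antimonoD[OF anti that(2)] that(1) by auto
  have "?S = {..<card ?S}"
  proof (cases "?S = {}")
    case False
    define M where "M = Max ?S"
    have "?S = {..M}"
    proof (intro set_eqI iffI)
      fix i assume "i \<in> ?S"
      then show "i \<in> {..M}" unfolding M_def using Max_ge[OF fin] by simp
    next
      fix i assume "i \<in> {..M}"
      then show "i \<in> ?S" unfolding M_def using down[OF Max_in[OF fin False]] by blast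
    qed
    then show ?thesis
      by (metis card_atMost lessThan_Suc_atMost)
  qed simp
  then show ?thesis
    unfolding num_parts_def by blast
qed

lemma count_list_map_upt: "count_list (map lam [0..<N]) v = part_mult N lam v"
proof (induction N)
  case (Suc N)
  have "{k. k < Suc N \<and> lam k = v} = (if lam N = v then insert N {k. k < N \<and> lam k = v} else {k. k < N \<and> lam k = v})"
    by (auto simp: less_Suc_eq)
  then show ?case using Suc by (simp add: part_mult_def)
qed (simp add: part_mult_def)

lemma multiset_matching_poly_parts:
  "multiset_matching_poly t (map lam [0..<N]) = (\<Prod>v\<in>lam ` {..<N}. matching_poly t (part_mult N lam v))"
  unfolding multiset_matching_poly_def count_list_map_upt by (simp add: atLeast0LessThan)

lemma part_mult_double: "part_mult (2 * n) (double_parts \<mu>) v = 2 * part_mult n \<mu> v"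
proof -
  have "{k. k < 2 * n \<and> double_parts \<mu> k = v} = letters {k. k < n \<and> \<mu> k = v}"
    by (auto simp: letters_def double_parts_def)
  then show ?thesis
    unfolding part_mult_def by (simp add: card_letters)
qed

lemma image_double: "double_parts \<mu> ` {..<2 * n} = \<mu> ` {..<n}"
proof -
  have "\<mu> k \<in> double_parts \<mu> ` {..<2 * n}" if "k < n" for k
    using that by (intro image_eqI[of _ _ "2 * k"]) (auto simp: double_parts_def)
  then show ?thesis
    by (force simp: double_parts_def)
qed

lemma sum_part_mult: "(\<Sum>v\<in>lam ` {..<N}. part_mult N lam v) = N"
proof -
  have "{k. k < N \<and> lam k = v} = {k \<in> {..<N}. lam k = v}" for v
    by auto
  then show ?thesis
    unfolding part_mult_def using sum.group[of "{..<N}" "lam ` {..<N}" lam "\<lambda>_. 1 :: nat"] by simp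
qed

text \<open>If the parts at \<open>2i\<close> and \<open>2i + 1\<close> differed, the positions whose part is at least the one at \<open>2i\<close>
would be \<open>0, \<dots>, 2i\<close>.  Their number is odd, but it is also a sum of multiplicities.\<close>
lemma double_parts_if_even_multiplicities:
  assumes lam: "int_partition lam" "num_parts lam \<le> 2 * n"
    and even: "\<And>v. v \<in> lam ` {..<2 * n} \<Longrightarrow> even (part_mult (2 * n) lam v)"
  shows "\<exists>\<mu>. int_partition \<mu> \<and> lam = double_parts \<mu>"
proof -
  have anti: "antimono lam" and fin: "finite {i. lam i \<noteq> 0}"
    using lam by (auto simp: int_partition_def)
  define \<mu> where "\<mu> i = lam (2 * i)" for i
  have pair: "lam (2 * i + 1) = lam (2 * i)" for i
  proof (rule ccontr)
    assume neq: "lam (2 * i + 1) \<noteq> lam (2 * i)"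
    then have less: "lam (2 * i + 1) < lam (2 * i)"
      using antimonoD[OF anti, of "2 * i" "2 * i + 1"] by simp
    then have "lam (2 * i) \<noteq> 0" by simp
    then have i: "2 * i < 2 * n"
      using num_parts_support[OF lam(1), of "2 * i"] lam(2) by simp
    let ?V = "{v \<in> lam ` {..<2 * n}. lam (2 * i) \<le> v}"
    have "{..2 * i} = {k \<in> {..<2 * n}. lam (2 * i) \<le> lam k}"
    proof -
      have "lam (2 * i) \<le> lam k \<longleftrightarrow> k \<le> 2 * i" for k
        using antimonoD[OF anti, of k "2 * i"] antimonoD[OF anti, of "2 * i + 1" k] less
        by (cases "k \<le> 2 * i") auto
      then show ?thesis using i by auto
    qed
    then have "2 * i + 1 = card {k \<in> {..<2 * n}. lam (2 * i) \<le> lam k}"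
      by (metis card_atMost Suc_eq_plus1)
    also have "\<dots> = (\<Sum>v\<in>?V. \<Sum>k\<in>{k \<in> {k \<in> {..<2 * n}. lam (2 * i) \<le> lam k}. lam k = v}. 1)"
      by (subst sum.group) auto
    also have "\<dots> = (\<Sum>v\<in>?V. part_mult (2 * n) lam v)"
      by (intro sum.cong refl) (auto simp: part_mult_def intro!: arg_cong[where f = card])
    finally have eq: "2 * i + 1 = (\<Sum>v\<in>?V. part_mult (2 * n) lam v)" .
    have "odd (\<Sum>v\<in>?V. part_mult (2 * n) lam v)"
      unfolding eq[symmetric] by simp
    moreover have "even (\<Sum>v\<in>?V. part_mult (2 * n) lam v)"
      using even by (intro dvd_sum) auto
    ultimately show False by simp
  qed
  have "lam k = double_parts \<mu> k" for k
  proof (cases "even k")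
    case False
    then show ?thesis using pair[of "k div 2"] by (simp add: double_parts_def \<mu>_def)
  qed (simp add: double_parts_def \<mu>_def)
  moreover have "int_partition \<mu>"
  proof -
    have "antimono \<mu>"
      using anti by (auto simp: antimono_def \<mu>_def)
    moreover have "finite {i. \<mu> i \<noteq> 0}"
      using finite_vimageI[OF fin, of "(*) 2"] by (simp add: \<mu>_def vimage_def inj_on_def)
    ultimately show ?thesis by (simp add: int_partition_def)
  qed
  ultimately show ?thesis by blast
qed

lemma hl_phi_divide_power: "(\<Prod>j=1..k. (1 - s ^ j) / c) = hl_phi k s / c ^ k"
  by (simp add: hl_phi_def prod_dividef)

lemma hl_phi_neq_0: "norm s < 1 \<Longrightarrow> hl_phi k s \<noteq> 0"
  using one_minus_power_neq_0 by (auto simp: hl_phi_def)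

lemma prod_hl_phi_divide_power:
  "(\<Prod>v\<in>lam ` {..<N}. hl_phi (part_mult N lam v) s / c ^ part_mult N lam v) =
    (\<Prod>v\<in>lam ` {..<N}. hl_phi (part_mult N lam v) s) / c ^ N"
  by (simp add: prod_dividef sum_part_mult flip: power_sum)

lemma hl_v_eq: "hl_v N lam s = (\<Prod>v\<in>lam ` {..<N}. hl_phi (part_mult N lam v) s) / (1 - s) ^ N"
  unfolding hl_v_def hl_phi_divide_power by (rule prod_hl_phi_divide_power)

text \<open>The factors with odd exponents in the denominator are those of \<open>matching_poly_even\<close>.\<close>
lemma matching_poly_quotient:
  assumes "norm t < 1"
  shows "matching_poly t (2 * k) / (\<Prod>j=1..2 * k. (1 - t ^ j) / (1 - t)) =
    1 / (hl_phi k (t ^ 2) / (1 - t) ^ k)"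
proof -
  have t1: "t \<noteq> 1" using assms by auto
  have nz: "1 - t ^ j \<noteq> 0" if "j > 0" for j
    using one_minus_power_neq_0[OF assms that] .
  have "(\<Prod>j=1..2 * k. (1 - t ^ j) / (1 - t)) =
      (\<Prod>j=1..k. (1 - t ^ (2 * j - 1)) / (1 - t)) * (\<Prod>j=1..k. (1 - (t ^ 2) ^ j) / (1 - t))"
    by (induction k) (simp_all add: mult_ac flip: power_mult)
  also have "\<dots> = matching_poly t (2 * k) * (hl_phi k (t ^ 2) / (1 - t) ^ k)"
    unfolding matching_poly_even[OF t1] hl_phi_divide_power ..
  finally have eq: "(\<Prod>j=1..2 * k. (1 - t ^ j) / (1 - t)) =
      matching_poly t (2 * k) * (hl_phi k (t ^ 2) / (1 - t) ^ k)" .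
  have "matching_poly t (2 * k) \<noteq> 0"
    unfolding matching_poly_even[OF t1] using nz t1 by auto
  then show ?thesis unfolding eq by simp
qed

lemma integral_value_double:
  assumes "norm t < 1"
  shows "multiset_matching_poly t (map (double_parts \<mu>) [0..<2 * n]) / hl_v (2 * n) (double_parts \<mu>) t =
    (1 - t) ^ n / (\<Prod>v\<in>\<mu> ` {..<n}. hl_phi (part_mult n \<mu> v) (t ^ 2))"
proof -
  have "multiset_matching_poly t (map (double_parts \<mu>) [0..<2 * n]) / hl_v (2 * n) (double_parts \<mu>) t =
      (\<Prod>v\<in>\<mu> ` {..<n}. matching_poly t (2 * part_mult n \<mu> v) /
        (\<Prod>j=1..2 * part_mult n \<mu> v. (1 - t ^ j) / (1 - t)))"
    unfolding multiset_matching_poly_parts hl_v_def image_double part_mult_double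
    by (rule prod_dividef[symmetric])
  also have "\<dots> = 1 / (\<Prod>v\<in>\<mu> ` {..<n}. hl_phi (part_mult n \<mu> v) (t ^ 2) / (1 - t) ^ part_mult n \<mu> v)"
    unfolding matching_poly_quotient[OF assms] by (simp add: prod_dividef)
  also have "\<dots> = (1 - t) ^ n / (\<Prod>v\<in>\<mu> ` {..<n}. hl_phi (part_mult n \<mu> v) (t ^ 2))"
    unfolding prod_hl_phi_divide_power by simp
  finally show ?thesis .
qed

text \<open>The factors of the symbol are \<open>1 - s^(n - i)\<close>, also for \<open>s = 0\<close> by the convention for negative powers
of 0.  They are the factors that \<open>hl_phi n s\<close> has in addition to
\<open>hl_phi (n - num_parts \<mu>) s\<close>.\<close>
lemma C0_symbol_eq:
  assumes l: "num_parts \<mu> \<le> n"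
  shows "C0_symbol \<mu> (s ^ n) s * hl_phi (n - num_parts \<mu>) s = hl_phi n s"
proof -
  have factor: "s powi (- int i) * s ^ n = s ^ (n - i)" if "i < n" for i
  proof (cases "s = 0")
    case True
    then show ?thesis using that by (cases i) auto
  next
    case False
    then show ?thesis
      using that by (simp add: power_int_minus power_diff divide_inverse mult.commute)
  qed
  have "(\<Prod>i<m. 1 - s ^ (n - i)) * hl_phi (n - m) s = hl_phi n s" if "m \<le> n" for m
    using that
  proof (induction m)
    case (Suc m)
    have "n - m = Suc (n - Suc m)" using Suc.prems by simp
    then have "hl_phi (n - m) s = (1 - s ^ (n - m)) * hl_phi (n - Suc m) s"
      by (simp add: hl_phi_def mult.commute)
    then show ?case using Suc by (simp add: mult.assoc)
  qed simp
  moreover have "C0_symbol \<mu> (s ^ n) s = (\<Prod>i<num_parts \<mu>. 1 - s ^ (n - i))"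
    unfolding C0_symbol_def using factor l by (intro prod.cong) auto
  ultimately show ?thesis using l by simp
qed

text \<open>The factor \<open>hl_phi (n - num_parts \<mu>) s\<close> accounts for the parts equal to 0 among the first \<open>n\<close>, which the
symbol leaves out.\<close>
lemma Cminus_symbol_eq:
  assumes s: "norm s < 1" and \<mu>: "int_partition \<mu>" and l: "num_parts \<mu> \<le> n"
  shows "Cminus_symbol \<mu> s * hl_phi (n - num_parts \<mu>) s =
    (\<Prod>v\<in>\<mu> ` {..<n}. hl_phi (part_mult n \<mu> v) s)"
proof -
  note supp = num_parts_support[OF \<mu>]
  define l where "l = num_parts \<mu>"
  let ?V = "range \<mu> - {0}"
  have V: "?V = \<mu> ` {..<l}"
  proof -
    have eq: "{..<l} = {k. \<mu> k \<noteq> 0}" unfolding supp l_def lessThan_def ..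
    show ?thesis unfolding eq by auto
  qed
  have mult: "card {k. \<mu> k = v} = part_mult n \<mu> v" "card {k. \<mu> k = v} = part_mult l \<mu> v" if "v \<in> ?V" for v
  proof -
    have lt_l: "k < l" if "\<mu> k = v" for k
      using that \<open>v \<in> ?V\<close> supp[of k] unfolding l_def by blast
    have lt_n: "k < n" if "\<mu> k = v" for k
      using lt_l[OF that] assms(3) unfolding l_def by linarith
    have "{k. \<mu> k = v} = {k. k < n \<and> \<mu> k = v}" "{k. \<mu> k = v} = {k. k < l \<and> \<mu> k = v}"
      using lt_l lt_n by blast+
    then show "card {k. \<mu> k = v} = part_mult n \<mu> v" "card {k. \<mu> k = v} = part_mult l \<mu> v"
      unfolding part_mult_def by argo+
  qed
  have "1 - s \<noteq> 0" using s by auto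
  have "Cminus_symbol \<mu> s = (1 - s) ^ l * (\<Prod>v\<in>\<mu> ` {..<l}. hl_phi (part_mult l \<mu> v) s / (1 - s) ^ part_mult l \<mu> v)"
    unfolding Cminus_symbol_def hl_phi_divide_power l_def[symmetric] using mult(2)
    by (simp add: V)
  also have "\<dots> = (\<Prod>v\<in>\<mu> ` {..<l}. hl_phi (part_mult l \<mu> v) s)"
    unfolding prod_hl_phi_divide_power using \<open>1 - s \<noteq> 0\<close> by simp
  also have "\<dots> = (\<Prod>v\<in>?V. hl_phi (part_mult n \<mu> v) s)"
    using mult by (simp add: V)
  finally have C: "Cminus_symbol \<mu> s = (\<Prod>v\<in>?V. hl_phi (part_mult n \<mu> v) s)" .
  have fin: "finite ?V" unfolding V by simp
  have "part_mult n \<mu> 0 = n - l"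
  proof -
    have "\<mu> k = 0 \<longleftrightarrow> l \<le> k" for k
      using supp[of k] unfolding l_def by linarith
    then have eq: "{k. k < n \<and> \<mu> k = 0} = {l..<n}"
      by (simp only: atLeastLessThan_def atLeast_def lessThan_def Collect_conj_eq Int_commute)
    show ?thesis unfolding part_mult_def eq by simp
  qed
  then have "Cminus_symbol \<mu> s * hl_phi (n - l) s = (\<Prod>v\<in>insert 0 ?V. hl_phi (part_mult n \<mu> v) s)"
    unfolding C by (subst prod.insert[OF fin]) (simp_all add: mult.commute)
  also have "\<dots> = (\<Prod>v\<in>\<mu> ` {..<n}. hl_phi (part_mult n \<mu> v) s)"
  proof (rule prod.mono_neutral_right)
    show "\<forall>v\<in>insert 0 ?V - \<mu> ` {..<n}. hl_phi (part_mult n \<mu> v) s = 1"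
    proof
      fix v assume "v \<in> insert 0 ?V - \<mu> ` {..<n}"
      then have "{k. k < n \<and> \<mu> k = v} = {}" by auto
      then show "hl_phi (part_mult n \<mu> v) s = 1" by (simp add: part_mult_def hl_phi_def)
    qed
  qed (use fin in auto)
  finally show ?thesis by (simp add: l_def)
qed

theorem corollary6p3:
  fixes n :: nat and t sqrt_t :: complex and lam :: "nat \<Rightarrow> nat"
  assumes "n \<ge> 1"
    and "norm t < 1"
    and "sqrt_t ^ 2 = t"
    and "int_partition lam"
    and "num_parts lam \<le> 2 * n"
  shows
    "let Z = (LINT x|torus_measure n. koornwinder_density n sqrt_t (- sqrt_t) 0 0 t x);
         L = 1 / Z * (LINT x|torus_measure n.
               hall_littlewood (2 * n) lam t (inverse_pairs x) *
               koornwinder_density n sqrt_t (- sqrt_t) 0 0 t x)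
     in (\<forall>\<mu>. int_partition \<mu> \<and> lam = double_parts \<mu> \<longrightarrow>
           L = hl_phi n (t ^ 2) / ((1 - t ^ 2) ^ n * hl_v n \<mu> (t ^ 2)) \<and>
           hl_phi n (t ^ 2) / ((1 - t ^ 2) ^ n * hl_v n \<mu> (t ^ 2)) =
             C0_symbol \<mu> (t ^ (2 * n)) (t ^ 2) / Cminus_symbol \<mu> (t ^ 2)) \<and>
        ((\<nexists>\<mu>. int_partition \<mu> \<and> lam = double_parts \<mu>) \<longrightarrow> L = 0)"
proof -
  let ?K = "koornwinder_density n sqrt_t (- sqrt_t) 0 0 t"
  define Z where "Z = (LINT x|torus_measure n. ?K x)"
  define I where "I = (LINT x|torus_measure n. hall_littlewood (2 * n) lam t (inverse_pairs x) * ?K x)"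
  note integral = integral_hall_littlewood_density[OF assms(2,3)]
  have t1: "1 - t \<noteq> 0" using assms(2) by auto
  have t2: "norm (t ^ 2) < 1"
    using assms(2) by (simp add: norm_power power_less_one_iff)
  then have t21: "1 - t ^ 2 \<noteq> 0" by auto
  have I: "I = multiset_matching_poly t (map lam [0..<2 * n]) / hl_v (2 * n) lam t"
    unfolding I_def using assms(4) by (intro integral) (simp add: int_partition_def)
  have Z: "Z = (1 - t) ^ n / hl_phi n (t ^ 2)"
  proof -
    have anti: "antimono (\<lambda>_ :: nat. 0 :: nat)" by (simp add: antimono_def)
    \<comment> \<open>The density is integrated by inserting the Hall-Littlewood polynomial of the zero partition.\<close>
    have "Z = (LINT x|torus_measure n. hall_littlewood (2 * n) (\<lambda>_. 0) t (inverse_pairs x) * ?K x)"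
      unfolding Z_def
    proof (rule integral_cong_AE)
      show "?K \<in> borel_measurable (torus_measure n)"
        unfolding koornwinder_density_eq[OF assms(3)] torus_measure_eq
        by (intro borel_measurable_times borel_measurable_const borel_measurable_density_on) simp
      show "(\<lambda>x. hall_littlewood (2 * n) (\<lambda>_. 0) t (inverse_pairs x) * ?K x) \<in>
          borel_measurable (torus_measure n)"
        by (intro borel_measurable_integrable integrable_hall_littlewood_density assms anti)
      show "AE x in torus_measure n. ?K x = hall_littlewood (2 * n) (\<lambda>_. 0) t (inverse_pairs x) * ?K x"
        using AE_hall_littlewood_zero[OF assms(2,1)] by eventually_elim simp
    qed
    also have "\<dots> = multiset_matching_poly t (map (double_parts (\<lambda>_. 0)) [0..<2 * n]) /
        hl_v (2 * n) (double_parts (\<lambda>_. 0)) t"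
    proof -
      have "double_parts (\<lambda>_. 0) = (\<lambda>_. 0)"
        by (simp add: fun_eq_iff double_parts_def)
      then show ?thesis
        unfolding integral[OF anti] by simp
    qed
    also have "\<dots> = (1 - t) ^ n / hl_phi n (t ^ 2)"
    proof -
      have "(\<lambda>_. 0 :: nat) ` {..<n} = {0}"
        using assms(1) by (subst image_constant[of 0]) auto
      then show ?thesis
        unfolding integral_value_double[OF assms(2)] by (simp add: part_mult_def)
    qed
    finally show ?thesis .
  qed
  have "1 / Z * I = hl_phi n (t ^ 2) / ((1 - t ^ 2) ^ n * hl_v n \<mu> (t ^ 2)) \<and>
      hl_phi n (t ^ 2) / ((1 - t ^ 2) ^ n * hl_v n \<mu> (t ^ 2)) =
        C0_symbol \<mu> (t ^ (2 * n)) (t ^ 2) / Cminus_symbol \<mu> (t ^ 2)"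
    if \<mu>: "int_partition \<mu>" and double: "lam = double_parts \<mu>" for \<mu>
  proof -
    let ?D = "\<Prod>v\<in>\<mu> ` {..<n}. hl_phi (part_mult n \<mu> v) (t ^ 2)"
    have v: "(1 - t ^ 2) ^ n * hl_v n \<mu> (t ^ 2) = ?D"
      unfolding hl_v_eq using t21 by simp
    have "I = (1 - t) ^ n / ?D"
      unfolding I double by (rule integral_value_double[OF assms(2)])
    then have "1 / Z * I = hl_phi n (t ^ 2) / ?D"
      unfolding Z using t1 by simp
    moreover have "num_parts \<mu> \<le> n"
    proof (rule ccontr)
      assume "\<not> num_parts \<mu> \<le> n"
      then have "lam (2 * n) \<noteq> 0"
        unfolding double double_parts_def using num_parts_support[OF \<mu>, of n] by simp
      then show False
        using num_parts_support[OF assms(4), of "2 * n"] assms(5) by simp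
    qed
    then have "hl_phi n (t ^ 2) / ?D = C0_symbol \<mu> (t ^ (2 * n)) (t ^ 2) / Cminus_symbol \<mu> (t ^ 2)"
      using C0_symbol_eq[of \<mu> n "t ^ 2", symmetric] Cminus_symbol_eq[OF t2 \<mu>, of n, symmetric]
        hl_phi_neq_0[OF t2, of "n - num_parts \<mu>"]
      by (simp add: power_mult)
    ultimately show ?thesis unfolding v by simp
  qed
  moreover have "1 / Z * I = 0" if "\<nexists>\<mu>. int_partition \<mu> \<and> lam = double_parts \<mu>"
  proof -
    have "\<exists>v\<in>lam ` {..<2 * n}. odd (part_mult (2 * n) lam v)"
    proof (rule ccontr)
      assume "\<not> ?thesis"
      then have "\<exists>\<mu>. int_partition \<mu> \<and> lam = double_parts \<mu>"
        by (intro double_parts_if_even_multiplicities[OF assms(4,5)]) blast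
      with that show False by (rule notE)
    qed
    then obtain v where "v \<in> lam ` {..<2 * n}" "odd (part_mult (2 * n) lam v)" ..
    then have "multiset_matching_poly t (map lam [0..<2 * n]) = 0"
      unfolding multiset_matching_poly_parts
      by (intro prod_zero bexI[of _ v]) (simp_all add: matching_poly_odd)
    then show ?thesis by (simp add: I)
  qed
  ultimately show ?thesis
    unfolding Let_def Z_def[symmetric] I_def[symmetric] by blast
qed

end
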